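(* Consider the problem of minimizing $f(x)=\sum_{i\in V}f_i(x)$ over $x\in X$, with $X=X_0\cap\bigcap_{i\in V}X_i$, over a network of $N$ agents, and the Decentralized Approximate Projection (DAP) algorithm for it (see context). Suppose that conditions (A1)--(A5) of the context hold and that the optimal set $X^*=\operatorname{argmin}_{x\in X}f(x)$ is nonempty. Let the stepsize sequence $\{\alpha_k\}$ be nonnegative and nonincreasing with $\sum_{k=1}^\infty\alpha_k=\infty$ and $\sum_{k=1}^\infty\alpha_k^2<\infty$. Then the iterates $\{x_{i,k}\}$ generated by all agents $i\in V$ via DAP converge almost surely to the same point of $X^*$; i.e., there is a random point $x^\star\in X^*$ such that $$\lim_{k\to\infty}x_{i,k}=x^\star\quad\text{for all } i\in V\quad\text{almost surely.}$$
   Context: Network. $V=\{1,\dots,N\}$ is the set of agents; at each time $k\ge1$ communication is given by a digraph $G_k=(V,E_k)$, $E_k\subseteq V\times V$; $(j,i)\in E_k$ means that $j$ can send to $i$. $N_{i,k}^{\rm in}=\{j\in V:(j,i)\in E_k\}\cup\{i\}$. Problem. $f_i:\mathbb R^n\to\mathbb R$ for $i\in V$; $X_0\subseteq\mathbb R^n$; for each $i\in V$, $\Omega_i$ is a finite index set and $X_i=\{x\in\mathbb R^n: g(x,\omega)\le0\ \forall\omega\in\Omega_i\}$, where $g(\cdot,\omega)$ are real-valued constraint functions (the sets $\Omega_i$ may overlap). $X=X_0\cap\bigcap_{i\in V}X_i$. Put $g^+(x,\omega)=\max\{g(x,\omega),0\}$. $\|\cdot\|$ is the Euclidean norm, $\Pi_S$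 the Euclidean projection onto a closed convex set $S$, and $\mathrm{dist}(x,S)=\min_{v\in S}\|v-x\|$. DAP algorithm. Given $x_{i,0}\in X_0$ ($i\in V$), stepsizes $\alpha_k$ and $N\times N$ weight matrices $W_k$, for $k=1,2,\dots$ each agent $i$ computes $$p_{i,k}=\sum_{j\in V}[W_k]_{ij}x_{j,k-1},\quad v_{i,k}=\Pi_{X_0}[p_{i,k}-\alpha_k s_{i,k}],\quad x_{i,k}=\Pi_{X_0}\Big[v_{i,k}-\frac{g^+(v_{i,k},\omega_{i,k})}{\|d_{i,k}\|^2}d_{i,k}\Big],$$ where $s_{i,k}$ is a subgradient of $f_i$ at $p_{i,k}$, $\omega_{i,k}$ is a random variable with values in $\Omega_i$, $d_{i,k}\in\partial g^+(v_{i,k},\omega_{i,k})$ (subdifferential in the first argument) if $g^+(v_{i,k},\omega_{i,k})>0$, and $d_{i,k}=d_i$ for some fixed $d_i\neq0$ if $g^+(v_{i,k},\omega_{i,k})=0$. Let $\mathcal F_k=\{x_{i,0},(\omega_{i,t},1\le t\le k),i\in V\}$ be the history up to time $k$, $\mathcal F_0=\{x_{i,0},i\in V\}$. (A1) For all $k\ge1$: $[W_k]_{ij}\ge0$ for all $i,j$, and $[W_k]_{ij}=0$ if $j\notin N_{i,k}^{\rm in}$; there is a scalar $\nu\in(0,1)$ (independent of $k$) with $[W_k]_{ij}\ge\nu$ if $j\in N_{i,k}^{\rm in}$; and $W_k$ is doubly stochastic: $\sum_j[W_k]_{ij}=1$ for all $i$, $\sum_i[W_k]_{ij}=1$ for all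 $j$. (A2) $X_0$ is nonempty, closed and convex. Each $f_i$ is convex (not necessarily differentiable) over some open set containing $X_0$, and there are scalars $C_{f_i}$ with $\|s\|\le C_{f_i}$ for all $s\in\partial f_i(x)$, $x\in X_0$. For each $i\in V$, $\omega\in\Omega_i$, $g(\cdot,\omega)$ is defined and convex (not necessarily differentiable) over some open set containing $X_0$, and there is a scalar $C_g$ with $\|d\|\le C_g$ for all $d\in\partial g^+(x,\omega)$, $x\in X_0$, $\omega\in\Omega_i$, $i\in V$. (A3) For each $i$, the $\omega_{i,k}$, $k\ge1$, are i.i.d. samples from some probability distribution on the finite set $\Omega_i$, independent across agents, and each element of $\Omega_i$ has positive probability. (A4) For all $i\in V$ there exists a constant $c>0$ such that for all $x\in X_0$, $\mathrm{dist}^2(x,X)\le c\,\mathbb E[(g^+(x,\omega))^2\mid\mathcal F_{k-1}]$, where the expectation is over $\omega=\omega_{i,k}$ in $\Omega_i$ (by (A3) it is the expectation under the sampling distribution on $\Omega_i$). (A5) There is an integer $Q\ge1$ such that the graphs $(V,\bigcup_{\ell=0,\dots,Q-1}E_{k+\ell})$ are strongly connected for all $k\ge1$. *)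

theory Defs
  imports "HOL-Probability.Probability" "Graph_Theory.Digraph_Component"
begin

section \<open>Decentralized constrained optimization\<close>

text \<open>
  Agents are the numbers \<open>1..N\<close>; families indexed by agents or by agent pairs are functions on
  \<^typ>\<open>nat\<close> of which only the values at \<open>1..N\<close> matter, and time-indexed data other than the
  initial iterates is used for times \<open>k \<ge> 1\<close> only.

  Functions that are convex only on an open set containing \<open>X0\<close> are rendered as total functions
  together with such a set (\<open>Df i\<close> for \<open>f i\<close>, \<open>Dg w\<close> for \<open>g(\<cdot>, w)\<close>), playing the role of
  their effective domain: the subgradient inequality is required on that set. The subgradients
  do not depend on the open convex set chosen, since a subgradient inequality for a convex function
  that holds near a point holds on the whole set.
\<close>

definition subdifferential :: "'a::real_inner set \<Rightarrow> ('a \<Rightarrow> real) \<Rightarrow> 'a \<Rightarrow> 'a set" where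
  "subdifferential D h x = {s. \<forall>y\<in>D. h x + s \<bullet> (y - x) \<le> h y}"

definition gplus :: "('a \<Rightarrow> 'w \<Rightarrow> real) \<Rightarrow> 'a \<Rightarrow> 'w \<Rightarrow> real" where
  "gplus g x w = max (g x w) 0"

definition constraint_set :: "('a \<Rightarrow> 'w \<Rightarrow> real) \<Rightarrow> 'w set \<Rightarrow> 'a set" where
  "constraint_set g \<Omega>\<^sub>i = {x. \<forall>w\<in>\<Omega>\<^sub>i. g x w \<le> 0}"

definition feasible_set ::
  "nat \<Rightarrow> 'a set \<Rightarrow> ('a \<Rightarrow> 'w \<Rightarrow> real) \<Rightarrow> (nat \<Rightarrow> 'w set) \<Rightarrow> 'a set" where
  "feasible_set N X0 g \<Omega> = X0 \<inter> (\<Inter>i\<in>{1..N}. constraint_set g (\<Omega> i))"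

definition optimal_set ::
  "nat \<Rightarrow> 'a set \<Rightarrow> (nat \<Rightarrow> 'a \<Rightarrow> real) \<Rightarrow> ('a \<Rightarrow> 'w \<Rightarrow> real) \<Rightarrow> (nat \<Rightarrow> 'w set) \<Rightarrow> 'a set" where
  "optimal_set N X0 f g \<Omega> =
     {x. is_arg_min (\<lambda>y. \<Sum>i\<in>{1..N}. f i y) (\<lambda>y. y \<in> feasible_set N X0 g \<Omega>) x}"


section \<open>Network and weights\<close>

definition in_nbrs :: "nat \<Rightarrow> (nat \<times> nat) set \<Rightarrow> nat \<Rightarrow> nat set" where
  "in_nbrs N E i = {j \<in> {1..N}. (j, i) \<in> E} \<union> {i}"

definition weight_condition ::
  "nat \<Rightarrow> (nat \<Rightarrow> (nat \<times> nat) set) \<Rightarrow> (nat \<Rightarrow> nat \<Rightarrow> nat \<Rightarrow> real) \<Rightarrow> bool" where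
  "weight_condition N E W \<longleftrightarrow>
     (\<forall>k\<ge>1. \<forall>i\<in>{1..N}. \<forall>j\<in>{1..N}.
        0 \<le> W k i j \<and> (j \<notin> in_nbrs N (E k) i \<longrightarrow> W k i j = 0)) \<and>
     (\<exists>\<nu>::real. 0 < \<nu> \<and> \<nu> < 1 \<and>
        (\<forall>k\<ge>1. \<forall>i\<in>{1..N}. \<forall>j\<in>in_nbrs N (E k) i. \<nu> \<le> W k i j)) \<and>
     (\<forall>k\<ge>1. \<forall>i\<in>{1..N}. (\<Sum>j\<in>{1..N}. W k i j) = 1) \<and>
     (\<forall>k\<ge>1. \<forall>j\<in>{1..N}. (\<Sum>i\<in>{1..N}. W k i j) = 1)"

definition connectivity_condition :: "nat \<Rightarrow> (nat \<Rightarrow> (nat \<times> nat) set) \<Rightarrow> bool" where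
  "connectivity_condition N E \<longleftrightarrow>
     (\<exists>Q\<ge>1. \<forall>k\<ge>1.
        strongly_connected (with_proj \<lparr> pverts = {1..N}, parcs = (\<Union>l\<in>{0..Q - 1}. E (k + l)) \<rparr>))"


section \<open>Convexity, sampling and regularity conditions\<close>

definition convexity_condition ::
  "nat \<Rightarrow> 'a::euclidean_space set \<Rightarrow> (nat \<Rightarrow> 'a set) \<Rightarrow> (nat \<Rightarrow> 'a \<Rightarrow> real) \<Rightarrow>
   ('w \<Rightarrow> 'a set) \<Rightarrow> ('a \<Rightarrow> 'w \<Rightarrow> real) \<Rightarrow> (nat \<Rightarrow> 'w set) \<Rightarrow> bool" where
  "convexity_condition N X0 Df f Dg g \<Omega> \<longleftrightarrow>
     X0 \<noteq> {} \<and> closed X0 \<and> convex X0 \<and>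
     (\<forall>i\<in>{1..N}. open (Df i) \<and> X0 \<subseteq> Df i \<and> convex_on (Df i) (f i)) \<and>
     (\<exists>C::nat \<Rightarrow> real. \<forall>i\<in>{1..N}. \<forall>x\<in>X0. \<forall>s\<in>subdifferential (Df i) (f i) x. norm s \<le> C i) \<and>
     (\<forall>i\<in>{1..N}. \<forall>w\<in>\<Omega> i. open (Dg w) \<and> X0 \<subseteq> Dg w \<and> convex_on (Dg w) (\<lambda>x. g x w)) \<and>
     (\<exists>C::real. \<forall>i\<in>{1..N}. \<forall>w\<in>\<Omega> i. \<forall>x\<in>X0.
        \<forall>d\<in>subdifferential (Dg w) (\<lambda>y. gplus g y w) x. norm d \<le> C)"

definition initial_events ::
  "'p measure \<Rightarrow> nat \<Rightarrow> (nat \<Rightarrow> nat \<Rightarrow> 'p \<Rightarrow> 'a::topological_space) \<Rightarrow> 'p set set" where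
  "initial_events M N x = (\<Union>i\<in>{1..N}. {x i 0 -` A \<inter> space M |A. A \<in> sets borel})"

definition sample_events ::
  "'p measure \<Rightarrow> nat \<Rightarrow> (nat \<Rightarrow> nat \<Rightarrow> 'p \<Rightarrow> 'w) \<Rightarrow> nat set \<Rightarrow> 'p set set" where
  "sample_events M N \<omega> T = (\<Union>i\<in>{1..N}. \<Union>t\<in>T. {\<omega> i t -` A \<inter> space M |A. True})"

definition history ::
  "'p measure \<Rightarrow> nat \<Rightarrow> (nat \<Rightarrow> nat \<Rightarrow> 'p \<Rightarrow> 'a::topological_space) \<Rightarrow>
   (nat \<Rightarrow> nat \<Rightarrow> 'p \<Rightarrow> 'w) \<Rightarrow> nat \<Rightarrow> 'p measure" where
  "history M N x \<omega> k = sigma (space M) (initial_events M N x \<union> sample_events M N \<omega> {1..k})"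

text \<open>
  The distribution of \<open>\<omega> i k\<close> is the probability mass function \<open>P i\<close>, whose support is all of
  \<open>\<Omega> i\<close>. The initial iterates may be random; they are independent of the samples, so that the
  conditional expectation of \<open>(gplus g x (\<omega> i k))^2\<close> given the history up to time \<open>k - 1\<close>
  is the expectation under \<open>P i\<close>.
\<close>

definition sampling_condition ::
  "'p measure \<Rightarrow> nat \<Rightarrow> (nat \<Rightarrow> 'w set) \<Rightarrow> (nat \<Rightarrow> 'w pmf) \<Rightarrow>
   (nat \<Rightarrow> nat \<Rightarrow> 'p \<Rightarrow> 'a::topological_space) \<Rightarrow> (nat \<Rightarrow> nat \<Rightarrow> 'p \<Rightarrow> 'w) \<Rightarrow> bool" where
  "sampling_condition M N \<Omega> P x \<omega> \<longleftrightarrow>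
     (\<forall>i\<in>{1..N}. set_pmf (P i) = \<Omega> i) \<and>
     (\<forall>i\<in>{1..N}. \<forall>k\<ge>1. \<forall>\<xi>\<in>space M. \<omega> i k \<xi> \<in> \<Omega> i) \<and>
     prob_space.indep_vars M (\<lambda>_. count_space UNIV) (\<lambda>(i, k). \<omega> i k) ({1..N} \<times> {1..}) \<and>
     (\<forall>i\<in>{1..N}. \<forall>k\<ge>1. distr M (count_space UNIV) (\<omega> i k) = measure_pmf (P i)) \<and>
     prob_space.indep_set M
       (sigma_sets (space M) (initial_events M N x))
       (sigma_sets (space M) (sample_events M N \<omega> {1..}))"

definition regularity_condition ::
  "nat \<Rightarrow> 'a::euclidean_space set \<Rightarrow> ('a \<Rightarrow> 'w \<Rightarrow> real) \<Rightarrow> (nat \<Rightarrow> 'w set) \<Rightarrow> (nat \<Rightarrow> 'w pmf) \<Rightarrow> bool"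
  where
  "regularity_condition N X0 g \<Omega> P \<longleftrightarrow>
     (\<forall>i\<in>{1..N}. \<exists>c>0. \<forall>x\<in>X0.
        (infdist x (feasible_set N X0 g \<Omega>))\<^sup>2
          \<le> c * measure_pmf.expectation (P i) (\<lambda>w. (gplus g x w)\<^sup>2))"


section \<open>The decentralized approximate projection algorithm\<close>

text \<open>
  The subgradients are arbitrary selections, but an agent chooses them from what has happened so
  far: \<open>s i k\<close> is a function of the history up to time \<open>k - 1\<close>, and \<open>d i k\<close> of the history up to
  time \<open>k\<close>. This makes every iterate \<open>x i k\<close> a function of the history up to time \<open>k\<close>; without it
  a selection could anticipate future samples.
\<close>

definition dap_iterates ::
  "'p measure \<Rightarrow> nat \<Rightarrow> 'a::euclidean_space set \<Rightarrow> (nat \<Rightarrow> 'a set) \<Rightarrow> (nat \<Rightarrow> 'a \<Rightarrow> real) \<Rightarrow>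
   ('w \<Rightarrow> 'a set) \<Rightarrow> ('a \<Rightarrow> 'w \<Rightarrow> real) \<Rightarrow> (nat \<Rightarrow> nat \<Rightarrow> nat \<Rightarrow> real) \<Rightarrow> (nat \<Rightarrow> real) \<Rightarrow>
   (nat \<Rightarrow> 'a) \<Rightarrow> (nat \<Rightarrow> nat \<Rightarrow> 'p \<Rightarrow> 'w) \<Rightarrow> (nat \<Rightarrow> nat \<Rightarrow> 'p \<Rightarrow> 'a) \<Rightarrow> (nat \<Rightarrow> nat \<Rightarrow> 'p \<Rightarrow> 'a) \<Rightarrow>
   (nat \<Rightarrow> nat \<Rightarrow> 'p \<Rightarrow> 'a) \<Rightarrow> (nat \<Rightarrow> nat \<Rightarrow> 'p \<Rightarrow> 'a) \<Rightarrow> (nat \<Rightarrow> nat \<Rightarrow> 'p \<Rightarrow> 'a) \<Rightarrow> bool" where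
  "dap_iterates M N X0 Df f Dg g W \<alpha> d0 \<omega> s d p v x \<longleftrightarrow>
     (\<forall>i\<in>{1..N}. d0 i \<noteq> 0) \<and>
     (\<forall>i\<in>{1..N}. x i 0 \<in> borel_measurable M \<and> (\<forall>\<xi>\<in>space M. x i 0 \<xi> \<in> X0)) \<and>
     (\<forall>i\<in>{1..N}. \<forall>k\<ge>1.
        s i k \<in> borel_measurable (history M N x \<omega> (k - 1)) \<and>
        d i k \<in> borel_measurable (history M N x \<omega> k) \<and>
        (\<forall>\<xi>\<in>space M.
           p i k \<xi> = (\<Sum>j\<in>{1..N}. W k i j *\<^sub>R x j (k - 1) \<xi>) \<and>
           s i k \<xi> \<in> subdifferential (Df i) (f i) (p i k \<xi>) \<and>
           v i k \<xi> = closest_point X0 (p i k \<xi> - \<alpha> k *\<^sub>R s i k \<xi>) \<and>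
           (if gplus g (v i k \<xi>) (\<omega> i k \<xi>) > 0
            then d i k \<xi> \<in> subdifferential (Dg (\<omega> i k \<xi>)) (\<lambda>y. gplus g y (\<omega> i k \<xi>)) (v i k \<xi>)
            else d i k \<xi> = d0 i) \<and>
           x i k \<xi> = closest_point X0
             (v i k \<xi> - (gplus g (v i k \<xi>) (\<omega> i k \<xi>) / (norm (d i k \<xi>))\<^sup>2) *\<^sub>R d i k \<xi>)))"

end

theory Submission
  imports Defs
begin

text \<open>
  Randomness enters only through one estimate: with \<open>X\<close> the feasible set,
  \<open>\<Sum>k. (infdist (v i k) X)\<^sup>2 < \<infinity>\<close> almost surely. It is obtained by taking expectations, on the
  events that the initial iterates are bounded by \<open>R\<close> (these may fail to be integrable),
  in the one-step bound for the summed squared distances to \<open>X\<close>: each constraint step lowers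
  the sum by a multiple of \<open>(gplus g (v i k) (\<omega> i k))\<^sup>2\<close>, and since \<open>\<omega> i k\<close> is independent of the
  past, regularity bounds the expected decrease below by a multiple of \<open>(infdist (v i k) X)\<^sup>2\<close>.

  Everything else is deterministic along a path with this property. The deviations
  \<open>x i k - p i k\<close> are then square summable, hence so are the disagreements between agents, by the
  contraction of products of weight matrices over long windows. With \<open>y k\<close> the projection onto
  \<open>X\<close> of the iterate of agent 1 and \<open>F\<close> the total objective, the sum of squared distances to
  an optimal point decreases, up to a summable error, by \<open>2 * \<alpha> k * (F (y k) - min F)\<close>. So it
  converges, \<open>F (y k)\<close> tends to the minimum along a subsequence because \<open>\<Sum>k. \<alpha> k = \<infinity>\<close>, and
  a limit point of that subsequence is an optimal point at which the sum of squared distances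
  tends to zero.
\<close>

section \<open>Convexity and projections\<close>

text \<open>The epigraph is separated from the open vertical ray below \<open>(x, h x)\<close>.
  Since \<open>D\<close> is open, the separating hyperplane cannot be vertical, and its slope is the
  subgradient.\<close>

lemma subdifferential_nonempty:
  fixes h :: "'a::euclidean_space \<Rightarrow> real"
  assumes "open D" "convex_on D h" "x \<in> D"
  obtains u where "u \<in> subdifferential D h x"
proof -
  have "convex ({x} \<times> {..<h x})"
    by (intro convex_Times) auto
  moreover have "convex (epigraph D h)"
    using assms(2) by (rule convex_epigraphI)
  moreover have "(x, h x - 1) \<in> {x} \<times> {..<h x}" "(x, h x) \<in> epigraph D h"
    using assms(3) by (auto simp: mem_epigraph)
  moreover have "({x} \<times> {..<h x}) \<inter> epigraph D h = {}"
    by (auto simp: epigraph_def)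
  ultimately obtain a b where ab: "a \<noteq> 0" "\<forall>z\<in>{x} \<times> {..<h x}. a \<bullet> z \<le> b"
      "\<forall>z\<in>epigraph D h. a \<bullet> z \<ge> b"
    using separating_hyperplane_sets[of "{x} \<times> {..<h x}" "epigraph D h"] by blast
  obtain a1 a2 where a: "a = (a1, a2)" by (cases a)
  have low: "a1 \<bullet> x + a2 * t \<le> b" if "t < h x" for t
    using ab(2) that by (auto simp: a)
  have up: "a1 \<bullet> y + a2 * t \<ge> b" if "y \<in> D" "h y \<le> t" for y t
    using ab(3)[rule_format, of "(y, t)"] that by (simp add: a mem_epigraph)
  have "a2 \<ge> 0"
    using low[of "h x - 1"] up[OF assms(3), of "h x"] by (auto simp: algebra_simps)
  \<comment> \<open>The ray is open at its top, so \<open>h x\<close> is reached only as a limit.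
    Dividing by \<open>a2 + 1\<close> keeps the gap \<open>t < h x\<close> meaningful even while
    \<open>a2 = 0\<close> is not excluded.\<close>
  have key: "a1 \<bullet> x + a2 * h x \<le> b"
  proof (rule field_le_epsilon)
    fix e :: real assume "e > 0"
    define t where "t = h x - e / (a2 + 1)"
    have "t < h x" using \<open>e > 0\<close> \<open>a2 \<ge> 0\<close> by (simp add: t_def)
    have "a1 \<bullet> x + a2 * h x - a2 * (e / (a2 + 1)) \<le> b"
      using low[OF \<open>t < h x\<close>] by (simp add: t_def algebra_simps)
    moreover have "a2 * (e / (a2 + 1)) \<le> e"
      using \<open>e > 0\<close> \<open>a2 \<ge> 0\<close> by (simp add: field_simps)
    ultimately show "a1 \<bullet> x + a2 * h x \<le> b + e" by linarith
  qed
  have "a2 \<noteq> 0"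
  proof
    assume "a2 = 0"
    with ab(1) a have "a1 \<noteq> 0" by (auto simp: zero_prod_def)
    obtain e where e: "e > 0" "cball x e \<subseteq> D"
      using assms open_contains_cball by blast
    \<comment> \<open>A vertical hyperplane is refuted by moving from \<open>x\<close> against its
      normal while staying in \<open>D\<close>.\<close>
    define y where "y = x - (e / norm a1) *\<^sub>R a1"
    have "y \<in> D" using e \<open>a1 \<noteq> 0\<close> by (auto simp: y_def dist_norm subset_iff)
    then have "a1 \<bullet> y \<ge> a1 \<bullet> x"
      using up[of y "h y"] key \<open>a2 = 0\<close> by simp
    moreover have "a1 \<bullet> y = a1 \<bullet> x - e * norm a1"
      using \<open>a1 \<noteq> 0\<close> by (simp add: y_def inner_diff_right dot_square_norm power2_eq_square)
    ultimately show False using e \<open>a1 \<noteq> 0\<close> by (simp add: zero_le_mult_iff mult_le_0_iff)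
  qed
  with \<open>a2 \<ge> 0\<close> have "a2 > 0" by simp
  have "- (a1 /\<^sub>R a2) \<in> subdifferential D h x"
    unfolding subdifferential_def
  proof (intro CollectI ballI)
    fix y assume "y \<in> D"
    have "a1 \<bullet> x + a2 * h x \<le> a1 \<bullet> y + a2 * h y"
      using key up[OF \<open>y \<in> D\<close> order_refl] by simp
    then show "h x + - (a1 /\<^sub>R a2) \<bullet> (y - x) \<le> h y"
      using \<open>a2 > 0\<close> by (simp add: field_simps inner_diff_right)
  qed
  then show ?thesis by (rule that)
qed

text \<open>The subgradient is taken at \<open>z\<close>, the point whose value is bounded above,
  and Cauchy-Schwarz does the rest. Exchanging \<open>y\<close> and \<open>z\<close> gives the other
  side.\<close>

lemma convex_Lipschitz_if_subgradients_bounded: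
  fixes h :: "'a::euclidean_space \<Rightarrow> real"
  assumes "open D" "convex_on D h" "S \<subseteq> D"
    and bound: "\<And>z u. z \<in> S \<Longrightarrow> u \<in> subdifferential D h z \<Longrightarrow> norm u \<le> C"
    and "y \<in> S" "z \<in> S"
  shows "h z - h y \<le> C * dist y z"
proof -
  obtain u where u: "u \<in> subdifferential D h z"
    using subdifferential_nonempty[OF assms(1,2)] assms by blast
  then have "h z + u \<bullet> (y - z) \<le> h y"
    using assms by (auto simp: subdifferential_def)
  moreover have "\<bar>u \<bullet> (y - z)\<bar> \<le> norm u * dist y z"
    by (simp add: Cauchy_Schwarz_ineq2 dist_norm)
  moreover have "norm u * dist y z \<le> C * dist y z"
    using bound[OF _ u] assms by (intro mult_right_mono) auto
  ultimately show ?thesis by linarith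
qed

section \<open>Convex combinations and doubly stochastic averaging\<close>

lemma weighted_sum_power2_le:
  fixes a w :: "'i \<Rightarrow> real"
  assumes "finite I" "\<And>j. j \<in> I \<Longrightarrow> 0 \<le> w j" "(\<Sum>j\<in>I. w j) = 1"
  shows "(\<Sum>j\<in>I. w j * a j)\<^sup>2 \<le> (\<Sum>j\<in>I. w j * (a j)\<^sup>2)"
proof -
  have "I \<noteq> {}" using assms(3) by auto
  then show ?thesis
    using convex_on_sum[OF assms(1) _ convex_power2, of w a] assms by auto
qed

text \<open>The same combination of the nearest points lies in \<open>X\<close> by convexity and
  serves as comparison point.\<close>

lemma infdist_weighted_sum_le:
  fixes z :: "'i \<Rightarrow> 'a::euclidean_space"
  assumes "closed X" "convex X" "X \<noteq> {}"
    and "finite I" "\<And>j. j \<in> I \<Longrightarrow> 0 \<le> w j" "(\<Sum>j\<in>I. w j) = 1"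
  shows "infdist (\<Sum>j\<in>I. w j *\<^sub>R z j) X \<le> (\<Sum>j\<in>I. w j * infdist (z j) X)"
proof -
  have "\<exists>q. \<forall>j. q j \<in> X \<and> infdist (z j) X = dist (z j) (q j)"
    by (rule choice) (metis infdist_attains_inf[OF assms(1,3)])
  then obtain q where q: "\<And>j. q j \<in> X" "\<And>j. infdist (z j) X = dist (z j) (q j)"
    by blast
  have "(\<Sum>j\<in>I. w j *\<^sub>R q j) \<in> X"
    using assms q by (intro convex_sum) auto
  then have "infdist (\<Sum>j\<in>I. w j *\<^sub>R z j) X \<le> norm (\<Sum>j\<in>I. w j *\<^sub>R (z j - q j))"
    using infdist_le by (fastforce simp: dist_norm sum_subtractf scaleR_diff_right)
  also have "\<dots> \<le> (\<Sum>j\<in>I. norm (w j *\<^sub>R (z j - q j)))" by (rule norm_sum)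
  also have "\<dots> = (\<Sum>j\<in>I. w j * infdist (z j) X)"
    using assms(5) by (intro sum.cong) (auto simp: q(2) dist_norm)
  finally show ?thesis .
qed

text \<open>Row sums give Jensen's inequality for each agent; column sums ensure that each
  \<open>a j\<close> is counted once in total. It shows that mixing increases neither the summed
  squared distances to a point nor those to a convex set.\<close>

lemma sum_doubly_stochastic_power2_le:
  fixes w :: "'i \<Rightarrow> 'i \<Rightarrow> real" and a b :: "'i \<Rightarrow> real"
  assumes "finite I" "\<And>i j. i \<in> I \<Longrightarrow> j \<in> I \<Longrightarrow> 0 \<le> w i j"
    and row: "\<And>i. i \<in> I \<Longrightarrow> (\<Sum>j\<in>I. w i j) = 1"
    and col: "\<And>j. j \<in> I \<Longrightarrow> (\<Sum>i\<in>I. w i j) = 1"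
    and b: "\<And>i. i \<in> I \<Longrightarrow> 0 \<le> b i" "\<And>i. i \<in> I \<Longrightarrow> b i \<le> (\<Sum>j\<in>I. w i j * a j)"
  shows "(\<Sum>i\<in>I. (b i)\<^sup>2) \<le> (\<Sum>j\<in>I. (a j)\<^sup>2)"
proof -
  have "(\<Sum>i\<in>I. (b i)\<^sup>2) \<le> (\<Sum>i\<in>I. (\<Sum>j\<in>I. w i j * a j)\<^sup>2)"
    by (intro sum_mono power_mono b)
  also have "\<dots> \<le> (\<Sum>i\<in>I. \<Sum>j\<in>I. w i j * (a j)\<^sup>2)"
    by (intro sum_mono weighted_sum_power2_le assms)
  also have "\<dots> = (\<Sum>j\<in>I. (\<Sum>i\<in>I. w i j) * (a j)\<^sup>2)"
    by (subst sum.swap) (simp add: sum_distrib_right)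
  also have "\<dots> = (\<Sum>j\<in>I. (a j)\<^sup>2)"
    using col by (intro sum.cong) auto
  finally show ?thesis .
qed

lemma norm_weighted_sum_diff_le:
  fixes z :: "'i \<Rightarrow> 'a::real_normed_vector"
  assumes "\<And>j. j \<in> I \<Longrightarrow> 0 \<le> w j" "(\<Sum>j\<in>I. w j) = 1"
  shows "norm ((\<Sum>j\<in>I. w j *\<^sub>R z j) - y) \<le> (\<Sum>j\<in>I. w j * norm (z j - y))"
proof -
  have "(\<Sum>j\<in>I. w j *\<^sub>R z j) - y = (\<Sum>j\<in>I. w j *\<^sub>R (z j - y))"
    using assms(2) by (simp add: scaleR_diff_right sum_subtractf flip: scaleR_sum_left)
  also have "norm \<dots> \<le> (\<Sum>j\<in>I. norm (w j *\<^sub>R (z j - y)))" by (rule norm_sum)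
  also have "\<dots> = (\<Sum>j\<in>I. w j * norm (z j - y))"
    using assms(1) by (intro sum.cong) auto
  finally show ?thesis .
qed

section \<open>Progress of projected steps\<close>

text \<open>The projection is nonexpansive and fixes \<open>y\<close>; the rest is expanding a
  square. Both the objective step and the constraint step are instances.\<close>

lemma projected_step_le:
  fixes S :: "'a::euclidean_space set"
  assumes "closed S" "convex S" "y \<in> S"
  shows "(norm (closest_point S (q - u) - y))\<^sup>2 \<le> (norm (q - y))\<^sup>2 - 2 * (u \<bullet> (q - y)) + (norm u)\<^sup>2"
proof -
  have "norm (closest_point S (q - u) - y) \<le> norm ((q - u) - y)"
    using closest_point_lipschitz[of S "q - u" y] assms closest_point_self[of y S]
    by (auto simp: dist_norm)
  then have "(norm (closest_point S (q - u) - y))\<^sup>2 \<le> (norm ((q - u) - y))\<^sup>2"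
    by (intro power_mono) auto
  also have "\<dots> = (norm (q - y))\<^sup>2 - 2 * (u \<bullet> (q - y)) + (norm u)\<^sup>2"
    by (simp add: power2_norm_eq_inner inner_diff_left inner_diff_right inner_commute)
  finally show ?thesis .
qed

lemma gplus_nonneg [simp]: "0 \<le> gplus g x w"
  by (simp add: gplus_def)

lemma convex_on_gplus:
  assumes "convex_on D (\<lambda>y. g y w)"
  shows "convex_on D (\<lambda>y. gplus g y w)"
  unfolding convex_on_def
proof (intro conjI ballI allI impI)
  show "convex D" using assms by (simp add: convex_on_def)
  fix y y' and t t' :: real
  assume *: "y \<in> D" "y' \<in> D" "0 \<le> t" "0 \<le> t'" "t + t' = 1"
  then have "g (t *\<^sub>R y + t' *\<^sub>R y') w \<le> t * g y w + t' * g y' w"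
    using assms by (simp add: convex_on_def)
  also have "\<dots> \<le> t * gplus g y w + t' * gplus g y' w"
    using * by (intro add_mono mult_left_mono) (auto simp: gplus_def)
  finally show "gplus g (t *\<^sub>R y + t' *\<^sub>R y') w \<le> t * gplus g y w + t' * gplus g y' w"
    using * by (simp add: gplus_def[of g "t *\<^sub>R y + t' *\<^sub>R y'" w])
qed

text \<open>If \<open>e = 0\<close> while the constraint is violated at \<open>v\<close>, division by zero would
  suppress the step; a feasible \<open>y\<close> rules this out.\<close>

lemma polyak_step_le:
  fixes S :: "'a::euclidean_space set" and g :: "'a \<Rightarrow> 'w \<Rightarrow> real"
  assumes "closed S" "convex S" "y \<in> S" "y \<in> D" "g y w \<le> 0"
    and e: "if gplus g v w > 0 then e \<in> subdifferential D (\<lambda>y. gplus g y w) v else e = e0" "e0 \<noteq> 0"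
    and x: "x = closest_point S (v - (gplus g v w / (norm e)\<^sup>2) *\<^sub>R e)"
  shows "(norm (x - y))\<^sup>2 \<le> (norm (v - y))\<^sup>2 - (gplus g v w / norm e)\<^sup>2"
    and "e \<noteq> 0" and "gplus g v w \<le> norm e * norm (v - y)"
proof -
  have gy: "gplus g y w = 0" using assms(5) by (simp add: gplus_def)
  have sub: "gplus g v w \<le> e \<bullet> (v - y)" if "gplus g v w > 0"
    using e(1) \<open>y \<in> D\<close> gy that by (auto simp: subdifferential_def inner_diff_right)
  show "e \<noteq> 0"
    using sub e by (auto split: if_splits)
  show "gplus g v w \<le> norm e * norm (v - y)"
    using sub norm_cauchy_schwarz[of e "v - y"] gplus_nonneg[of g v w]
    by (cases "gplus g v w > 0") (auto intro: order_trans simp: not_less order_antisym)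
  \<comment> \<open>With this step length the inner product term is at least
    \<open>(gplus g v w / norm e)\<^sup>2\<close> and the squared step equals it. They enter with
    factors -2 and +1, which leaves the claimed decrease.\<close>
  define t where "t = gplus g v w / (norm e)\<^sup>2"
  have t: "t * gplus g v w = (gplus g v w / norm e)\<^sup>2"
      "(norm (t *\<^sub>R e))\<^sup>2 = (gplus g v w / norm e)\<^sup>2"
    using \<open>e \<noteq> 0\<close> by (auto simp: t_def power2_eq_square)
  have "t * gplus g v w \<le> t * (e \<bullet> (v - y))"
  proof (cases "gplus g v w > 0")
    case True
    then show ?thesis using sub by (intro mult_left_mono) (auto simp: t_def)
  next
    case False
    then have "gplus g v w = 0" using gplus_nonneg[of g v w] by linarith
    then show ?thesis by (simp add: t_def)
  qed
  then show "(norm (x - y))\<^sup>2 \<le> (norm (v - y))\<^sup>2 - (gplus g v w / norm e)\<^sup>2"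
    using projected_step_le[OF assms(1-3), of v "t *\<^sub>R e"] t
    by (simp add: x flip: t_def)
qed

section \<open>Consensus\<close>

text \<open>The entry of the product of the matrices \<open>W (s + n)\<close>, ...,
  \<open>W (s + 1)\<close>: the share of agent \<open>l\<close> at time \<open>s\<close> in the
  value of agent \<open>i\<close> at time \<open>s + n\<close> under pure averaging. Only weights at
  times at least 1 occur.\<close>

primrec transition ::
  "nat \<Rightarrow> (nat \<Rightarrow> nat \<Rightarrow> nat \<Rightarrow> real) \<Rightarrow> nat \<Rightarrow> nat \<Rightarrow> nat \<Rightarrow> nat \<Rightarrow> real" where
  "transition N W s 0 i l = (if i = l then 1 else 0)"
| "transition N W s (Suc n) i l = (\<Sum>j\<in>{1..N}. W (s + Suc n) i j * transition N W s n j l)"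

lemma weight_conditionD:
  assumes "weight_condition N E W" "k \<ge> 1"
  shows "i \<in> {1..N} \<Longrightarrow> j \<in> {1..N} \<Longrightarrow> 0 \<le> W k i j"
    and "i \<in> {1..N} \<Longrightarrow> (\<Sum>j\<in>{1..N}. W k i j) = 1"
    and "j \<in> {1..N} \<Longrightarrow> (\<Sum>i\<in>{1..N}. W k i j) = 1"
  using assms by (auto simp: weight_condition_def)

lemma transition_nonneg:
  assumes "weight_condition N E W" "i \<in> {1..N}"
  shows "0 \<le> transition N W s n i l"
  using assms(2)
  by (induction n arbitrary: i) (auto intro!: sum_nonneg mult_nonneg_nonneg weight_conditionD[OF assms(1)])

lemma transition_row_sum:
  assumes "weight_condition N E W" "i \<in> {1..N}"
  shows "(\<Sum>l\<in>{1..N}. transition N W s n i l) = 1"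
  using assms(2)
proof (induction n arbitrary: i)
  case (Suc n)
  have "(\<Sum>l\<in>{1..N}. transition N W s (Suc n) i l)
      = (\<Sum>j\<in>{1..N}. W (s + Suc n) i j * (\<Sum>l\<in>{1..N}. transition N W s n j l))"
    by (simp add: sum_distrib_left) (rule sum.swap)
  also have "\<dots> = (\<Sum>j\<in>{1..N}. W (s + Suc n) i j)"
    using Suc.IH by (intro sum.cong) auto
  finally show ?case
    using weight_conditionD(2)[OF assms(1), of "s + Suc n" i] Suc.prems by simp
qed simp

lemma transition_step_ge:
  assumes w: "weight_condition N E W" and "i \<in> {1..N}" "j \<in> {1..N}"
    and "\<nu> \<le> W (s + Suc n) i j" "0 \<le> \<nu>" "\<eta> \<le> transition N W s n j l" "0 \<le> \<eta>"
  shows "\<nu> * \<eta> \<le> transition N W s (Suc n) i l"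
proof -
  have "\<nu> * \<eta> \<le> W (s + Suc n) i j * transition N W s n j l"
    using assms by (intro mult_mono) auto
  also have "\<dots> \<le> transition N W s (Suc n) i l"
    unfolding transition.simps
    using assms(2,3) transition_nonneg[OF w] weight_conditionD(1)[OF w]
    by (intro member_le_sum[of j]) auto
  finally show ?thesis .
qed

text \<open>If no arc left \<open>S\<close>, induction along a path starting in \<open>S\<close>
  would keep the whole path inside \<open>S\<close>, although some vertex outside is
  reachable.\<close>

lemma strongly_connected_crossing_arc:
  assumes "strongly_connected (with_proj \<lparr> pverts = V, parcs = A \<rparr>)"
    and "S \<subseteq> V" "S \<noteq> {}" "S \<noteq> V"
  obtains j i where "(j, i) \<in> A" "j \<in> S" "i \<notin> S"
proof (rule ccontr)
  assume no: "\<not> thesis"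
  obtain u v where u: "u \<in> S" and v: "v \<in> V" "v \<notin> S" using assms by auto
  have "u \<rightarrow>\<^sup>*\<^bsub>with_proj \<lparr> pverts = V, parcs = A \<rparr>\<^esub> v"
    using assms(1,2) u v by (auto simp: strongly_connected_def)
  then have "(u, v) \<in> A\<^sup>*"
    using reachable_rtranclI by fastforce
  then have "v \<in> S"
  proof (induction rule: rtrancl_induct)
    case (step y z)
    then show ?case using no that by auto
  qed (rule u)
  with v show False by simp
qed

text \<open>A fixed column of the transition matrix becomes positive: the set of agents reached with
  weight at least \<open>\<nu> ^ n\<close> never loses a member and gains one in every window of length \<open>Q\<close>.\<close>

lemma transition_column_pos:
  assumes w: "weight_condition N E W" and c: "connectivity_condition N E"
    and E: "\<And>k. k \<ge> 1 \<Longrightarrow> E k \<subseteq> {1..N} \<times> {1..N}"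
  obtains \<eta> :: real and T :: nat where "0 < \<eta>" "\<eta> < 1"
    "\<And>s i l. i \<in> {1..N} \<Longrightarrow> l \<in> {1..N} \<Longrightarrow> \<eta> \<le> transition N W s T i l"
proof -
  obtain \<nu> where \<nu>: "0 < \<nu>" "\<nu> < 1"
      and W\<nu>: "\<And>k i j. k \<ge> 1 \<Longrightarrow> i \<in> {1..N} \<Longrightarrow> j \<in> in_nbrs N (E k) i \<Longrightarrow> \<nu> \<le> W k i j"
    using w by (auto simp: weight_condition_def)
  obtain Q where Q: "Q \<ge> 1" and conn: "\<And>k. k \<ge> 1 \<Longrightarrow>
      strongly_connected (with_proj \<lparr> pverts = {1..N}, parcs = (\<Union>l\<in>{0..Q - 1}. E (k + l)) \<rparr>)"
    using c by (auto simp: connectivity_condition_def)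
  define R where "R s l n = {i \<in> {1..N}. \<nu> ^ n \<le> transition N W s n i l}" for s l n
  have step: "i \<in> R s l (Suc n)"
    if "i \<in> {1..N}" "j \<in> R s l n" "j \<in> in_nbrs N (E (s + Suc n)) i" for i j s l n
    using that \<nu> transition_step_ge[OF w, of i j \<nu> s n "\<nu> ^ n" l] W\<nu>[of "s + Suc n" i j]
    by (auto simp: R_def)
  \<comment> \<open>Each agent is its own in-neighbour, so its diagonal weight is at least
    \<open>\<nu>\<close>.\<close>
  have mono1: "R s l n \<subseteq> R s l (Suc n)" for s l n
  proof
    fix i assume "i \<in> R s l n"
    then show "i \<in> R s l (Suc n)"
      by (intro step[of i i]) (auto simp: R_def in_nbrs_def)
  qed
  have mono: "R s l n \<subseteq> R s l m" if "n \<le> m" for s l n m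
    using that lift_Suc_mono_le[of "R s l" n m] mono1 by blast
  have grow: "R s l n = {1..N} \<or> R s l n \<subset> R s l (n + Q)" if "l \<in> R s l n" for s l n
  proof (cases "R s l n = {1..N}")
    case False
    have sub: "R s l n \<subseteq> {1..N}" by (auto simp: R_def)
    have ne: "R s l n \<noteq> {}" using that by blast
    \<comment> \<open>A product of \<open>n\<close> factors has used the weights up to time
      \<open>s + n\<close>, so the connectivity window starts one later. An arc at offset
      \<open>t < Q\<close> takes effect after \<open>n + t + 1\<close> factors, hence within
      \<open>n + Q\<close>.\<close>
    have "Suc (s + n) \<ge> 1" by simp
    from strongly_connected_crossing_arc[OF conn[OF this] sub ne False]
    obtain j i where ji: "(j, i) \<in> (\<Union>t\<in>{0..Q - 1}. E (Suc (s + n) + t))"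
        and j: "j \<in> R s l n" and i: "i \<notin> R s l n" by blast
    from ji obtain t where "t \<in> {0..Q - 1}" "(j, i) \<in> E (Suc (s + n) + t)" by blast
    with Q have t: "t < Q" "(j, i) \<in> E (s + Suc (n + t))" by (simp_all add: add.assoc)
    then have ij: "i \<in> {1..N}" "j \<in> {1..N}" using E[of "s + Suc (n + t)"] by auto
    have "j \<in> R s l (n + t)" using mono[of n "n + t"] j by auto
    with ij t have "i \<in> R s l (Suc (n + t))"
      by (intro step[of i j]) (auto simp: in_nbrs_def)
    then have "i \<in> R s l (n + Q)" using mono[of "Suc (n + t)" "n + Q"] t by auto
    with i mono[of n "n + Q" s l] show ?thesis by auto
  qed simp
  \<comment> \<open>Zero factors already reach \<open>l\<close> itself, so \<open>m\<close> windows
    reach more than \<open>m\<close> agents unless all are reached. For \<open>m = N\<close> only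
    the second alternative remains.\<close>
  have card: "R s l (m * Q) = {1..N} \<or> m < card (R s l (m * Q))" if l: "l \<in> {1..N}" for s l m
  proof (induction m)
    case 0
    then show ?case using l by (auto simp: R_def card_gt_0_iff)
  next
    case (Suc m)
    have R0: "l \<in> R s l 0" using l by (simp add: R_def)
    have fin: "finite (R s l n)" "R s l n \<subseteq> {1..N}" for n by (auto simp: R_def)
    from mono[of "m * Q" "m * Q + Q" s l] fin(2)[of "m * Q + Q"]
    have sat: "R s l (m * Q) = {1..N} \<Longrightarrow> R s l (m * Q + Q) = {1..N}" by auto
    have "l \<in> R s l (m * Q)" using mono[of 0 "m * Q" s l] R0 by auto
    from grow[OF this] consider "R s l (m * Q) = {1..N}" | "R s l (m * Q) \<subset> R s l (m * Q + Q)"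
      by blast
    then have "R s l (m * Q + Q) = {1..N} \<or> Suc m < card (R s l (m * Q + Q))"
    proof cases
      case 2
      with psubset_card_mono[OF fin(1) 2] Suc sat show ?thesis by linarith
    qed (simp add: sat)
    then show ?case by (simp add: add.commute)
  qed
  have full: "R s l (N * Q) = {1..N}" if "l \<in> {1..N}" for s l
  proof -
    have "card (R s l (N * Q)) \<le> card {1..N}" by (intro card_mono) (auto simp: R_def)
    with card[OF that, of s N] show ?thesis by auto
  qed
  show ?thesis
  \<comment> \<open>Without agents the exponent would be 0 and the bound 1, which violates
    \<open>\<eta> < 1\<close>; any constant does then.\<close>
  proof (cases "N = 0")
    case True
    then show ?thesis by (intro that[of "1/2" 0]) simp_all
  next
    case False
    with Q have "0 < N * Q" by simp
    from power_strict_decreasing[OF this \<nu>] have "\<nu> ^ (N * Q) < 1" by simp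
    moreover have "0 < \<nu> ^ (N * Q)" using \<nu> by simp
    moreover have "\<nu> ^ (N * Q) \<le> transition N W s (N * Q) i l" if "i \<in> {1..N}" "l \<in> {1..N}" for s i l
      using full[OF that(2), of s] that(1) unfolding R_def by blast
    ultimately show ?thesis by (intro that[of "\<nu> ^ (N * Q)" "N * Q"])
  qed
qed

section \<open>Contraction of the disagreement\<close>

text \<open>Both rows give mass at least \<open>\<eta>\<close> to \<open>l0\<close>, and this common
  part cancels in the difference. What remains, rescaled by \<open>1 - \<eta>\<close> to the weights
  \<open>c\<close>, yields two convex combinations of the \<open>z l\<close>, at distance at most
  \<open>\<delta>\<close>.\<close>

lemma stochastic_rows_contract:
  fixes z :: "'i \<Rightarrow> 'a::real_normed_vector" and a b :: "'i \<Rightarrow> real"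
  assumes "finite I" "l0 \<in> I" "0 < \<eta>" "\<eta> < 1" "\<eta> \<le> a l0" "\<eta> \<le> b l0"
    and "\<And>l. l \<in> I \<Longrightarrow> 0 \<le> a l" "\<And>l. l \<in> I \<Longrightarrow> 0 \<le> b l"
    and "(\<Sum>l\<in>I. a l) = 1" "(\<Sum>l\<in>I. b l) = 1"
    and diam: "\<And>l m. l \<in> I \<Longrightarrow> m \<in> I \<Longrightarrow> norm (z l - z m) \<le> \<delta>"
  shows "norm ((\<Sum>l\<in>I. a l *\<^sub>R z l) - (\<Sum>l\<in>I. b l *\<^sub>R z l)) \<le> (1 - \<eta>) * \<delta>"
proof -
  define c where "c = (\<lambda>(a :: 'i \<Rightarrow> real) l. (a l - (if l = l0 then \<eta> else 0)) / (1 - \<eta>))"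
  have c1: "(\<Sum>l\<in>I. c u l) = 1" if "(\<Sum>l\<in>I. u l) = 1" for u
    using assms(1-4) that by (simp add: c_def flip: sum_divide_distrib) (simp add: sum_subtractf)
  have c0: "0 \<le> c u l" if "\<And>l. l \<in> I \<Longrightarrow> 0 \<le> u l" "\<eta> \<le> u l0" "l \<in> I" for u l
    using that assms(4) by (auto simp: c_def)
  have dec: "(\<Sum>l\<in>I. u l *\<^sub>R z l) = \<eta> *\<^sub>R z l0 + (1 - \<eta>) *\<^sub>R (\<Sum>l\<in>I. c u l *\<^sub>R z l)" for u
  proof -
    have "(1 - \<eta>) *\<^sub>R (\<Sum>l\<in>I. c u l *\<^sub>R z l) = (\<Sum>l\<in>I. u l *\<^sub>R z l - (if l = l0 then \<eta> *\<^sub>R z l else 0))"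
      unfolding scaleR_sum_right using assms(4)
      by (intro sum.cong refl) (auto simp: c_def scaleR_diff_left)
    then show ?thesis using assms(1,2) by (simp add: sum_subtractf)
  qed
  have inner: "norm ((\<Sum>l\<in>I. c b l *\<^sub>R z l) - z m) \<le> \<delta>" if "m \<in> I" for m
  proof -
    have "norm ((\<Sum>l\<in>I. c b l *\<^sub>R z l) - z m) \<le> (\<Sum>l\<in>I. c b l * norm (z l - z m))"
      using assms by (intro norm_weighted_sum_diff_le c0 c1) auto
    also have "\<dots> \<le> (\<Sum>l\<in>I. c b l * \<delta>)"
      using assms that by (intro sum_mono mult_left_mono diam c0) auto
    also have "\<dots> = \<delta>" using c1[of b] assms by (simp flip: sum_distrib_right)
    finally show ?thesis .
  qed
  have "norm ((\<Sum>l\<in>I. c a l *\<^sub>R z l) - (\<Sum>l\<in>I. c b l *\<^sub>R z l))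
      \<le> (\<Sum>l\<in>I. c a l * norm (z l - (\<Sum>l\<in>I. c b l *\<^sub>R z l)))"
    using assms by (intro norm_weighted_sum_diff_le c0 c1) auto
  also have "\<dots> \<le> (\<Sum>l\<in>I. c a l * \<delta>)"
    using assms inner by (intro sum_mono mult_left_mono c0) (auto simp: norm_minus_commute)
  also have "\<dots> = \<delta>" using c1[of a] assms by (simp flip: sum_distrib_right)
  finally have "(1 - \<eta>) * norm ((\<Sum>l\<in>I. c a l *\<^sub>R z l) - (\<Sum>l\<in>I. c b l *\<^sub>R z l)) \<le> (1 - \<eta>) * \<delta>"
    using assms(4) by (intro mult_left_mono) auto
  moreover have "(\<Sum>l\<in>I. a l *\<^sub>R z l) - (\<Sum>l\<in>I. b l *\<^sub>R z l)
      = (1 - \<eta>) *\<^sub>R ((\<Sum>l\<in>I. c a l *\<^sub>R z l) - (\<Sum>l\<in>I. c b l *\<^sub>R z l))"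
    unfolding dec[of a] dec[of b] by (simp add: scaleR_diff_right)
  ultimately show ?thesis using assms(4) by simp
qed

text \<open>Averaging with a stochastic row does not enlarge the errors accumulated so far, and each
  step adds at most one new \<open>\<epsilon>\<close>.\<close>

lemma transition_perturbed:
  fixes z :: "nat \<Rightarrow> nat \<Rightarrow> 'a::real_normed_vector"
  assumes w: "weight_condition N E W"
    and eps: "\<And>i k. i \<in> {1..N} \<Longrightarrow>
      norm (z i (Suc k) - (\<Sum>j\<in>{1..N}. W (Suc k) i j *\<^sub>R z j k)) \<le> \<epsilon> k"
    and "i \<in> {1..N}"
  shows "norm (z i (s + n) - (\<Sum>l\<in>{1..N}. transition N W s n i l *\<^sub>R z l s)) \<le> (\<Sum>t<n. \<epsilon> (s + t))"
  using assms(3)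
proof (induction n arbitrary: i)
  case 0
  have "(\<Sum>l\<in>{1..N}. (if i = l then 1 else 0) *\<^sub>R z l s) = (\<Sum>l\<in>{1..N}. if i = l then z l s else 0)"
    by (intro sum.cong) auto
  then show ?case using 0 by simp
next
  case (Suc n)
  let ?y = "\<lambda>j. \<Sum>l\<in>{1..N}. transition N W s n j l *\<^sub>R z l s"
  let ?W = "W (Suc (s + n)) i"
  have "(\<Sum>l\<in>{1..N}. transition N W s (Suc n) i l *\<^sub>R z l s) = (\<Sum>j\<in>{1..N}. ?W j *\<^sub>R ?y j)"
    by (simp add: scaleR_sum_left scaleR_sum_right) (rule sum.swap)
  then have "z i (s + Suc n) - (\<Sum>l\<in>{1..N}. transition N W s (Suc n) i l *\<^sub>R z l s)
      = (z i (Suc (s + n)) - (\<Sum>j\<in>{1..N}. ?W j *\<^sub>R z j (s + n)))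
        + (\<Sum>j\<in>{1..N}. ?W j *\<^sub>R (z j (s + n) - ?y j))"
    by (simp add: scaleR_diff_right sum_subtractf)
  moreover have "norm (\<Sum>j\<in>{1..N}. ?W j *\<^sub>R (z j (s + n) - ?y j)) \<le> (\<Sum>t<n. \<epsilon> (s + t))"
  proof -
    have "norm ((\<Sum>j\<in>{1..N}. ?W j *\<^sub>R (z j (s + n) - ?y j)) - 0)
        \<le> (\<Sum>j\<in>{1..N}. ?W j * norm (z j (s + n) - ?y j - 0))"
      using Suc.prems by (intro norm_weighted_sum_diff_le weight_conditionD[OF w]) auto
    also have "\<dots> \<le> (\<Sum>j\<in>{1..N}. ?W j * (\<Sum>t<n. \<epsilon> (s + t)))"
      using Suc by (intro sum_mono mult_left_mono weight_conditionD[OF w]) auto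
    also have "\<dots> = (\<Sum>t<n. \<epsilon> (s + t))"
      using weight_conditionD(2)[OF w, of "Suc (s + n)" i] Suc.prems by (simp flip: sum_distrib_right)
    finally show ?thesis by simp
  qed
  ultimately show ?case
    using eps[OF Suc.prems, of "s + n"]
    by (simp only: sum.lessThan_Suc) (smt (verit) norm_triangle_ineq)
qed

text \<open>Summing the recursion reproduces the partial sum of \<open>u\<close> on both sides,
  except for the first \<open>T\<close> terms. The factor \<open>1 - \<eta>\<close> lets it be
  absorbed on the left.\<close>

lemma summable_if_lagged_contraction:
  fixes u b :: "nat \<Rightarrow> real"
  assumes "\<And>k. 0 \<le> u k" "\<And>k. 0 \<le> b k" "summable b" "0 < \<eta>"
    and step: "\<And>k. u (k + T) \<le> (1 - \<eta>) * u k + b k"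
  shows "summable u"
proof (rule bounded_imp_summable)
  fix n
  have sum_split: "(\<Sum>k<T + m. u k) = (\<Sum>k<T. u k) + (\<Sum>k<m. u (k + T))" for m
    by (induction m) (simp_all add: ac_simps)
  have "(\<Sum>k\<le>n. u k) \<le> (\<Sum>k<T + Suc n. u k)"
    using assms(1) by (intro sum_mono2) auto
  also have "\<dots> = (\<Sum>k<T. u k) + (\<Sum>k<Suc n. u (k + T))"
    by (rule sum_split)
  also have "(\<Sum>k<Suc n. u (k + T)) \<le> (\<Sum>k<Suc n. (1 - \<eta>) * u k + b k)"
    by (intro sum_mono step)
  also have "\<dots> = (1 - \<eta>) * (\<Sum>k\<le>n. u k) + (\<Sum>k<Suc n. b k)"
    by (simp add: sum.distrib sum_distrib_left lessThan_Suc_atMost)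
  also have "(\<Sum>k<Suc n. b k) \<le> suminf b"
    using assms by (intro sum_le_suminf) auto
  finally have "\<eta> * (\<Sum>k\<le>n. u k) \<le> (\<Sum>k<T. u k) + suminf b"
    by (simp add: algebra_simps)
  then show "(\<Sum>k\<le>n. u k) \<le> ((\<Sum>k<T. u k) + suminf b) / \<eta>"
    using assms(4) by (simp add: field_simps)
qed (use assms in auto)

lemma summable_sum_power2:
  fixes a :: "'i \<Rightarrow> nat \<Rightarrow> real"
  assumes "\<And>i. i \<in> I \<Longrightarrow> summable (\<lambda>k. (a i k)\<^sup>2)"
  shows "summable (\<lambda>k. (\<Sum>i\<in>I. a i k)\<^sup>2)"
proof (rule summable_comparison_test)
  show "summable (\<lambda>k. (\<Sum>i\<in>I. (a i k)\<^sup>2) * card I)"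
    using assms by (intro summable_mult2 summable_sum)
qed (use sum_squared_le_sum_of_squares in auto)

text \<open>The diameter \<open>D\<close> of the agents' values shrinks by the factor
  \<open>1 - \<eta>\<close> over \<open>T\<close> steps, up to the perturbations in between;
  squaring this recursion makes the lagged contraction applicable.\<close>

lemma consensus_square_summable:
  fixes z :: "nat \<Rightarrow> nat \<Rightarrow> 'a::real_normed_vector"
  assumes w: "weight_condition N E W" and c: "connectivity_condition N E"
    and E: "\<And>k. k \<ge> 1 \<Longrightarrow> E k \<subseteq> {1..N} \<times> {1..N}"
    and sq: "\<And>i. i \<in> {1..N} \<Longrightarrow>
      summable (\<lambda>k. (norm (z i (Suc k) - (\<Sum>j\<in>{1..N}. W (Suc k) i j *\<^sub>R z j k)))\<^sup>2)"
    and "i \<in> {1..N}" "j \<in> {1..N}"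
  shows "summable (\<lambda>k. (norm (z i k - z j k))\<^sup>2)"
proof -
  obtain \<eta> T where \<eta>: "0 < \<eta>" "\<eta> < 1"
      and pos: "\<And>s i l. i \<in> {1..N} \<Longrightarrow> l \<in> {1..N} \<Longrightarrow> \<eta> \<le> transition N W s T i l"
    using transition_column_pos[OF w c E] by blast
  define \<epsilon> where "\<epsilon> k = (\<Sum>i\<in>{1..N}. norm (z i (Suc k) - (\<Sum>j\<in>{1..N}. W (Suc k) i j *\<^sub>R z j k)))" for k
  define D where "D k = Max ((\<lambda>(i, j). norm (z i k - z j k)) ` ({1..N} \<times> {1..N}))" for k
  have D_ge: "norm (z i k - z j k) \<le> D k" if "i \<in> {1..N}" "j \<in> {1..N}" for i j k
    unfolding D_def using that by (intro Max_ge) (auto intro!: image_eqI[where x = "(i, j)"])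
  have D0: "0 \<le> D k" for k
    using D_ge[OF assms(5,5), of k] by simp
  have \<epsilon>: "norm (z i (Suc k) - (\<Sum>j\<in>{1..N}. W (Suc k) i j *\<^sub>R z j k)) \<le> \<epsilon> k" if "i \<in> {1..N}" for i k
    unfolding \<epsilon>_def using that by (intro member_le_sum) auto
  \<comment> \<open>The factor 2 accounts for the two agents being compared.\<close>
  define e where "e k = 2 * (\<Sum>t<T. \<epsilon> (k + t))" for k
  have step: "D (k + T) \<le> (1 - \<eta>) * D k + e k" for k
  proof -
    have "norm (z i (k + T) - z j (k + T)) \<le> (1 - \<eta>) * D k + e k"
      if ij: "i \<in> {1..N}" "j \<in> {1..N}" for i j
    proof -
      let ?y = "\<lambda>i. \<Sum>l\<in>{1..N}. transition N W k T i l *\<^sub>R z l k"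
      have "norm (?y i - ?y j) \<le> (1 - \<eta>) * D k"
        using ij \<eta> pos transition_nonneg[OF w] transition_row_sum[OF w] D_ge
        by (intro stochastic_rows_contract[where ?l0.0 = i]) auto
      moreover have "norm (z i (k + T) - ?y i) \<le> e k / 2" "norm (z j (k + T) - ?y j) \<le> e k / 2"
        using transition_perturbed[OF w \<epsilon>] ij by (auto simp: e_def)
      moreover have "z i (k + T) - z j (k + T)
          = (?y i - ?y j) + (z i (k + T) - ?y i) - (z j (k + T) - ?y j)" by simp
      ultimately show ?thesis
        by (smt (verit) norm_triangle_ineq norm_triangle_ineq4 field_sum_of_halves)
    qed
    then show ?thesis unfolding D_def[of "k + T"] using assms(5) by (subst Max_le_iff) auto
  qed
  have sq_step: "(D (k + T))\<^sup>2 \<le> (1 - \<eta>) * (D k)\<^sup>2 + (e k)\<^sup>2 / \<eta>" for k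
  proof -
    \<comment> \<open>Writing \<open>e k\<close> as \<open>\<eta> * (e k / \<eta>)\<close> exhibits
      a convex combination. Convexity of the square then leaves the contraction factor
      \<open>1 - \<eta>\<close> and no cross term.\<close>
    have "(D (k + T))\<^sup>2 \<le> ((1 - \<eta>) * D k + \<eta> * (e k / \<eta>))\<^sup>2"
      using step[of k] D0 \<eta> by (intro power_mono) auto
    also have "\<dots> \<le> (1 - \<eta>) * (D k)\<^sup>2 + \<eta> * (e k / \<eta>)\<^sup>2"
      using convex_onD[OF convex_power2, of \<eta> "D k" "e k / \<eta>"] \<eta> by simp
    finally show ?thesis using \<eta> by (simp add: power2_eq_square)
  qed
  have "summable (\<lambda>k. (\<epsilon> k)\<^sup>2)"
    unfolding \<epsilon>_def by (intro summable_sum_power2 sq)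
  then have "summable (\<lambda>k. (\<epsilon> (k + t))\<^sup>2)" for t
    by (rule summable_ignore_initial_segment)
  then have "summable (\<lambda>k. (e k)\<^sup>2 / \<eta>)"
    unfolding e_def power_mult_distrib by (intro summable_divide summable_mult summable_sum_power2)
  then have "summable (\<lambda>k. (D k)\<^sup>2)"
    using sq_step \<eta> by (intro summable_if_lagged_contraction[of "\<lambda>k. (D k)\<^sup>2" "\<lambda>k. (e k)\<^sup>2 / \<eta>"]) auto
  then show ?thesis
    by (rule summable_comparison_test'[of _ 0]) (use D_ge[OF assms(5,6)] in \<open>auto intro: power_mono\<close>)
qed

section \<open>Convergence along a path\<close>

lemma summable_mult_square_summable:
  fixes a b :: "nat \<Rightarrow> real"
  assumes "summable (\<lambda>k. (a k)\<^sup>2)" "summable (\<lambda>k. (b k)\<^sup>2)"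
  shows "summable (\<lambda>k. a k * b k)"
proof (rule summable_comparison_test'[of _ 0])
  show "summable (\<lambda>k. (a k)\<^sup>2 + (b k)\<^sup>2)"
    using assms by (rule summable_add)
  fix k
  have "2 * (\<bar>a k\<bar> * \<bar>b k\<bar>) \<le> \<bar>a k\<bar>\<^sup>2 + \<bar>b k\<bar>\<^sup>2"
    using sum_squares_bound[of "\<bar>a k\<bar>" "\<bar>b k\<bar>"] by simp
  then show "norm (a k * b k) \<le> (a k)\<^sup>2 + (b k)\<^sup>2"
    using mult_nonneg_nonneg[OF abs_ge_zero[of "a k"] abs_ge_zero[of "b k"]]
    by (simp add: abs_mult del: mult_nonneg_nonneg)
qed

text \<open>Subtracting the partial sums of \<open>b\<close> from \<open>u\<close> gives a
  nonincreasing sequence that is bounded below; telescoping bounds the partial sums of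
  \<open>c\<close>. It is used along paths and also for sequences of expectations.\<close>

lemma perturbed_descent:
  fixes u c b :: "nat \<Rightarrow> real"
  assumes "\<And>k. 0 \<le> u k" "\<And>k. 0 \<le> c k" "\<And>k. 0 \<le> b k" "summable b"
    and step: "\<And>k. u (Suc k) + c k \<le> u k + b k"
  shows "convergent u" and "summable c"
proof -
  define a where "a n = u n - (\<Sum>k<n. b k)" for n
  have sum_le: "(\<Sum>k<n. b k) \<le> suminf b" for n
    using assms by (intro sum_le_suminf) auto
  have "decseq a"
    by (rule decseq_SucI) (use step assms(2) in \<open>simp add: a_def, smt (verit)\<close>)
  moreover have "- suminf b \<le> a n" for n
    using assms(1)[of n] sum_le[of n] by (simp add: a_def)
  ultimately have "convergent a"
    by (metis decseq_convergent convergent_def)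
  moreover have "convergent (\<lambda>n. \<Sum>k<n. b k)"
    using assms(4) by (simp add: summable_iff_convergent)
  ultimately have "convergent (\<lambda>n. a n + (\<Sum>k<n. b k))"
    by (rule convergent_add)
  then show "convergent u" by (simp add: a_def)
  have c_le: "u n + (\<Sum>k<n. c k) \<le> u 0 + (\<Sum>k<n. b k)" for n
  proof (induction n)
    case (Suc n)
    then show ?case using step[of n] by simp
  qed simp
  show "summable c"
  proof (rule bounded_imp_summable)
    fix n
    show "(\<Sum>k\<le>n. c k) \<le> u 0 + suminf b"
      using c_le[of "Suc n"] assms(1)[of "Suc n"] sum_le[of "Suc n"]
      by (simp add: lessThan_Suc_atMost)
  qed (use assms in auto)
qed

text \<open>If \<open>c\<close> stayed above some \<open>e > 0\<close> from some index on, then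
  \<open>e * a k\<close> would be dominated by a summable sequence. So arbitrarily late indices with
  small \<open>c\<close> exist and can be chosen increasingly.\<close>

lemma subsequence_tendsto_zero_if_weighted_summable:
  fixes a c :: "nat \<Rightarrow> real"
  assumes "\<And>k. 0 \<le> a k" "\<And>k. 0 \<le> c k" "\<not> summable a" "summable (\<lambda>k. a k * c k)"
  obtains r where "strict_mono r" "(\<lambda>n. c (r n)) \<longlonglongrightarrow> 0"
proof -
  have small: "\<exists>k\<ge>m. c k < e" if "e > 0" for m e
  proof (rule ccontr)
    assume "\<not> ?thesis"
    then have "e * a k \<le> a k * c k" if "k \<ge> m" for k
      using that assms(1)[of k] by (metis mult.commute mult_left_mono not_less)
    then have "summable (\<lambda>k. e * a k)"
      using assms(1) \<open>e > 0\<close> by (intro summable_comparison_test'[OF assms(4), of m]) auto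
    then have "summable a" using \<open>e > 0\<close> by (simp add: summable_cmult_iff)
    with assms(3) show False by simp
  qed
  have "\<exists>r. \<forall>n. c (r n) < 1 / real (Suc n) \<and> r n < r (Suc n)"
  proof (rule dependent_nat_choice)
    show "\<exists>k. c k < 1 / real (Suc 0)" using small[of 1 0] by auto
    fix k n
    show "\<exists>l. c l < 1 / real (Suc (Suc n)) \<and> k < l"
      using small[of "1 / real (Suc (Suc n))" "Suc k"] by auto
  qed
  then obtain r where r: "\<And>n. c (r n) < 1 / real (Suc n)" "\<And>n. r n < r (Suc n)" by blast
  have "(\<lambda>n. c (r n)) \<longlonglongrightarrow> 0"
  proof (rule tendsto_sandwich[of "\<lambda>_. 0" _ _ "\<lambda>n. 1 / real (Suc n)"])
    show "(\<lambda>n. 1 / real (Suc n)) \<longlonglongrightarrow> 0"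
      using LIMSEQ_inverse_real_of_nat by (simp add: inverse_eq_divide)
    show "\<forall>\<^sub>F n in sequentially. c (r n) \<le> 1 / real (Suc n)"
      using r(1) by (intro always_eventually allI less_imp_le)
  qed (use assms(2) in auto)
  then show ?thesis using that r(2) strict_mono_Suc_iff by blast
qed

lemma square_summable_tendsto_zero:
  fixes a :: "nat \<Rightarrow> real"
  assumes "summable (\<lambda>k. (a k)\<^sup>2)"
  shows "a \<longlonglongrightarrow> 0"
  using summable_LIMSEQ_zero[OF assms] by simp

section \<open>Convergence to a common minimiser for a fixed outcome\<close>

text \<open>The deterministic half of the argument, with \<open>S\<close> in the role of
  \<open>X0\<close>. Indices are shifted: \<open>q i k\<close> (mixing), \<open>v i k\<close>
  (objective step) and \<open>a k\<close> belong to the update from \<open>z i k\<close> to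
  \<open>z i (Suc k)\<close>.\<close>

lemma approximate_projection_convergence:
  fixes X S :: "'a::euclidean_space set" and f :: "nat \<Rightarrow> 'a \<Rightarrow> real"
    and z q v :: "nat \<Rightarrow> nat \<Rightarrow> 'a" and a :: "nat \<Rightarrow> real"
    and N :: nat
  defines "F \<equiv> \<lambda>y. \<Sum>i\<in>{1..N}. f i y"
  assumes w: "weight_condition N E W" and c: "connectivity_condition N E"
    and E: "\<And>k. k \<ge> 1 \<Longrightarrow> E k \<subseteq> {1..N} \<times> {1..N}" and N: "N \<ge> 1"
    and X: "closed X" "X \<subseteq> S" and "0 \<le> C"
    and lip: "\<And>i y y'. i \<in> {1..N} \<Longrightarrow> y \<in> S \<Longrightarrow> y' \<in> S \<Longrightarrow> f i y' - f i y \<le> C * dist y y'"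
    and opt: "is_arg_min F (\<lambda>y. y \<in> X) xs"
    and a: "\<And>k. 0 \<le> a k" "\<not> summable a" "summable (\<lambda>k. (a k)\<^sup>2)"
    and q: "\<And>i k. i \<in> {1..N} \<Longrightarrow> q i k = (\<Sum>j\<in>{1..N}. W (Suc k) i j *\<^sub>R z j k)"
      "\<And>i k. i \<in> {1..N} \<Longrightarrow> q i k \<in> S"
    and vq: "\<And>i k. i \<in> {1..N} \<Longrightarrow> norm (v i k - q i k) \<le> C * a k"
    and zv: "\<And>i k. i \<in> {1..N} \<Longrightarrow> norm (z i (Suc k) - v i k) \<le> infdist (v i k) X"
    and desc: "\<And>i k y. i \<in> {1..N} \<Longrightarrow> y \<in> X \<Longrightarrow>
      (norm (z i (Suc k) - y))\<^sup>2 \<le> (norm (q i k - y))\<^sup>2 - 2 * a k * (f i (q i k) - f i y) + (C * a k)\<^sup>2"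
    and v: "\<And>i. i \<in> {1..N} \<Longrightarrow> summable (\<lambda>k. (infdist (v i k) X)\<^sup>2)"
  obtains y where "is_arg_min F (\<lambda>y. y \<in> X) y" "\<And>i. i \<in> {1..N} \<Longrightarrow> z i \<longlonglongrightarrow> y"
proof -
  have one: "1 \<in> {1..N}" using N by simp
  have "xs \<in> X" and Fxs: "\<And>y. y \<in> X \<Longrightarrow> F xs \<le> F y"
    using opt by (auto simp: is_arg_min_linorder)
  then have "X \<noteq> {}" by auto
  have "summable (\<lambda>k. (norm (z i (Suc k) - q i k))\<^sup>2)" if i: "i \<in> {1..N}" for i
  proof (rule summable_comparison_test'[of _ 0])
    show "summable (\<lambda>k. 2 * ((infdist (v i k) X)\<^sup>2 + (C * a k)\<^sup>2))"
      unfolding power_mult_distrib using i by (intro summable_mult summable_add v a)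
    fix k
    have "norm (z i (Suc k) - q i k) \<le> infdist (v i k) X + C * a k"
      using norm_triangle_ineq[of "z i (Suc k) - v i k" "v i k - q i k"] vq[OF i, of k] zv[OF i, of k]
      by simp
    then have "(norm (z i (Suc k) - q i k))\<^sup>2 \<le> (infdist (v i k) X + C * a k)\<^sup>2"
      by (intro power_mono) auto
    also have "\<dots> \<le> 2 * ((infdist (v i k) X)\<^sup>2 + (C * a k)\<^sup>2)"
      using sum_squares_bound[of "infdist (v i k) X" "C * a k"] by (simp add: power2_sum)
    finally show "norm ((norm (z i (Suc k) - q i k))\<^sup>2) \<le> 2 * ((infdist (v i k) X)\<^sup>2 + (C * a k)\<^sup>2)"
      by simp
  qed
  then have cons: "summable (\<lambda>k. (norm (z i k - z j k))\<^sup>2)" if "i \<in> {1..N}" "j \<in> {1..N}" for i j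
    using that by (intro consensus_square_summable[OF w c E]) (auto simp: q(1))
  define \<delta> where "\<delta> k = (\<Sum>i\<in>{1..N}. norm (z i k - z 1 k))" for k
  have \<delta>_sq: "summable (\<lambda>k. (\<delta> k)\<^sup>2)"
    unfolding \<delta>_def by (intro summable_sum_power2 cons one)
  have \<delta>_ge: "norm (z i k - z 1 k) \<le> \<delta> k" if "i \<in> {1..N}" for i k
    unfolding \<delta>_def using that by (intro member_le_sum) auto
  have q1: "norm (q i k - z 1 k) \<le> \<delta> k" if i: "i \<in> {1..N}" for i k
  proof -
    have "norm (q i k - z 1 k) \<le> (\<Sum>j\<in>{1..N}. W (Suc k) i j * norm (z j k - z 1 k))"
      unfolding q(1)[OF i] using i by (intro norm_weighted_sum_diff_le weight_conditionD[OF w]) auto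
    also have "\<dots> \<le> (\<Sum>j\<in>{1..N}. W (Suc k) i j * \<delta> k)"
      using i by (intro sum_mono mult_left_mono \<delta>_ge weight_conditionD[OF w]) auto
    also have "\<dots> = \<delta> k"
      using weight_conditionD(2)[OF w, of "Suc k" i] i by (simp flip: sum_distrib_right)
    finally show ?thesis .
  qed
  have "\<exists>y. \<forall>k. y k \<in> X \<and> infdist (z 1 k) X = dist (z 1 k) (y k)"
    by (rule choice) (metis infdist_attains_inf[OF X(1) \<open>X \<noteq> {}\<close>])
  then obtain y where y: "\<And>k. y k \<in> X" "\<And>k. infdist (z 1 k) X = dist (z 1 k) (y k)" by blast
  \<comment> \<open>Summability is known for the distances of \<open>v\<close>, not of
    \<open>z\<close>. The iterate \<open>z 1 k\<close> is therefore compared with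
    \<open>v 1 k\<close>, which is computed from it: mixing moves it by at most
    \<open>\<delta> k\<close>, the objective step by at most \<open>C * a k\<close>.\<close>
  define \<rho> where "\<rho> k = \<delta> k + C * a k + infdist (v 1 k) X" for k
  have z1: "norm (z 1 k - y k) \<le> \<rho> k" for k
  proof -
    have "norm (z 1 k - y k) \<le> infdist (v 1 k) X + dist (z 1 k) (v 1 k)"
      using infdist_triangle[of "z 1 k" X "v 1 k"] y(2)[of k] by (simp add: dist_norm)
    also have "dist (z 1 k) (v 1 k) \<le> norm (v 1 k - q 1 k) + norm (q 1 k - z 1 k)"
      using dist_triangle[of "z 1 k" "v 1 k" "q 1 k"] by (simp add: dist_norm norm_minus_commute)
    finally show ?thesis using vq[OF one, of k] q1[OF one, of k] by (simp add: \<rho>_def)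
  qed
  have \<rho>_sq: "summable (\<lambda>k. (\<rho> k)\<^sup>2)"
  proof -
    \<comment> \<open>The three terms are presented as a sum over an index set so that the lemma on
      finite sums applies.\<close>
    have "summable (\<lambda>k. (\<Sum>m\<in>{0,1,2::nat}.
        (if m = 0 then \<delta> k else if m = 1 then C * a k else infdist (v 1 k) X))\<^sup>2)"
      by (rule summable_sum_power2) (use \<delta>_sq a(3) v[OF one] in \<open>auto simp: power_mult_distrib\<close>)
    then show ?thesis by (simp add: \<rho>_def add.assoc)
  qed
  have \<rho>0: "0 \<le> \<rho> k" for k using norm_ge_zero z1 order_trans by blast
  have \<delta>0: "0 \<le> \<delta> k" for k by (auto simp: \<delta>_def intro: sum_nonneg)
  \<comment> \<open>Per agent, \<open>b\<close> collects the Lipschitz cost of replacing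
    \<open>q i k\<close> by \<open>y k\<close> and the squared step. The point \<open>y k\<close> is
    common to all agents, so local gaps add up to a gap of \<open>F\<close>; it is feasible, so
    against a minimiser this gap is nonnegative, which may fail at \<open>q i k\<close>.\<close>
  define b where "b k = real N * (2 * C * (a k * \<delta> k) + 2 * C * (a k * \<rho> k) + (C * a k)\<^sup>2)" for k
  have "summable b"
    unfolding b_def power_mult_distrib
    by (intro summable_mult summable_add summable_mult_square_summable a \<delta>_sq \<rho>_sq)
  have b0: "0 \<le> b k" for k
    unfolding b_def using a(1) \<open>0 \<le> C\<close> \<delta>0 \<rho>0 by (intro mult_nonneg_nonneg add_nonneg_nonneg) auto
  define u where "u x k = (\<Sum>i\<in>{1..N}. (norm (z i k - x))\<^sup>2)" for x k
  have u_step: "u x (Suc k) + 2 * a k * (F (y k) - F x) \<le> u x k + b k" if x: "x \<in> X" for x k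
  proof -
    have fi: "(norm (z i (Suc k) - x))\<^sup>2 \<le> (norm (q i k - x))\<^sup>2 - 2 * a k * (f i (y k) - f i x)
        + (2 * C * (a k * \<delta> k) + 2 * C * (a k * \<rho> k) + (C * a k)\<^sup>2)" if i: "i \<in> {1..N}" for i
    proof -
      have "f i (y k) - f i (q i k) \<le> C * dist (q i k) (y k)"
        using lip[OF i] q(2)[OF i] X(2) y(1) by blast
      also have "dist (q i k) (y k) \<le> norm (q i k - z 1 k) + norm (z 1 k - y k)"
        by (metis dist_norm dist_triangle)
      also have "\<dots> \<le> \<delta> k + \<rho> k" using q1[OF i] z1 by (intro add_mono) auto
      finally have "f i (y k) - f i (q i k) \<le> C * (\<delta> k + \<rho> k)"
        using \<open>0 \<le> C\<close> by (simp add: mult_left_mono)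
      then have "2 * a k * (f i (y k) - f i (q i k)) \<le> 2 * a k * (C * (\<delta> k + \<rho> k))"
        using a(1)[of k] by (intro mult_left_mono) auto
      then show ?thesis using desc[OF i x, of k] by (simp add: algebra_simps)
    qed
    have "u x (Suc k) \<le> (\<Sum>i\<in>{1..N}. (norm (q i k - x))\<^sup>2 - 2 * a k * (f i (y k) - f i x)
        + (2 * C * (a k * \<delta> k) + 2 * C * (a k * \<rho> k) + (C * a k)\<^sup>2))"
      unfolding u_def by (intro sum_mono fi)
    also have "\<dots> = (\<Sum>i\<in>{1..N}. (norm (q i k - x))\<^sup>2) - 2 * a k * (F (y k) - F x) + b k"
      by (simp add: sum.distrib sum_subtractf F_def b_def flip: sum_distrib_left)
    also have "(\<Sum>i\<in>{1..N}. (norm (q i k - x))\<^sup>2) \<le> u x k"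
      unfolding u_def
    proof (rule sum_doubly_stochastic_power2_le[where w = "W (Suc k)"])
      fix i assume i: "i \<in> {1..N}"
      show "norm (q i k - x) \<le> (\<Sum>j\<in>{1..N}. W (Suc k) i j * norm (z j k - x))"
        unfolding q(1)[OF i] using i by (intro norm_weighted_sum_diff_le weight_conditionD[OF w]) auto
    qed (use weight_conditionD[OF w, of "Suc k"] in auto)
    finally show ?thesis by simp
  qed
  have u0: "0 \<le> u x k" for x k by (auto simp: u_def intro: sum_nonneg)
  \<comment> \<open>Stated for every minimiser because it is used twice: for the given
    \<open>xs\<close>, to get bounded iterates and a good subsequence, and later for the limit point
    \<open>l\<close>.\<close>
  have conv: "convergent (u x)" "summable (\<lambda>k. 2 * a k * (F (y k) - F x))"
    if "x \<in> X" "\<And>y. y \<in> X \<Longrightarrow> F x \<le> F y" for x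
    using that u_step u0 b0 \<open>summable b\<close> y(1) a(1)
    by (auto intro!: perturbed_descent[of "u x" "\<lambda>k. 2 * a k * (F (y k) - F x)" b] mult_nonneg_nonneg)
  have sm: "summable (\<lambda>k. a k * (F (y k) - F xs))"
    using summable_mult[OF conv(2)[OF \<open>xs \<in> X\<close> Fxs], of "1/2"] by simp
  have gap: "0 \<le> F (y k) - F xs" for k using Fxs[OF y(1)] by simp
  obtain r where r: "strict_mono r" "(\<lambda>n. F (y (r n)) - F xs) \<longlonglongrightarrow> 0"
    by (rule subsequence_tendsto_zero_if_weighted_summable[OF a(1) gap a(2) sm])
  have "Bseq (u xs)"
    using conv(1)[OF \<open>xs \<in> X\<close> Fxs] by (rule convergent_imp_Bseq)
  then obtain B where "\<forall>k. norm (u xs k) \<le> B" by (rule BseqE)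
  then have B: "u xs k \<le> B" for k by (simp add: abs_le_iff)
  have "norm (z 1 k - xs) \<le> sqrt B" for k
  proof (rule real_le_rsqrt)
    have "(norm (z 1 k - xs))\<^sup>2 \<le> u xs k"
      unfolding u_def using one by (intro member_le_sum) auto
    then show "(norm (z 1 k - xs))\<^sup>2 \<le> B" using B[of k] by simp
  qed
  then have "bounded (range (\<lambda>n. z 1 (r n)))"
    by (intro boundedI[of _ "norm xs + sqrt B"]) (smt (verit) norm_triangle_sub rangeE)
  then obtain l r' where r': "strict_mono r'" "((\<lambda>n. z 1 (r n)) \<circ> r') \<longlonglongrightarrow> l"
    using bounded_imp_convergent_subsequence by blast
  define t where "t = r \<circ> r'"
  have t: "strict_mono t" "(\<lambda>n. z 1 (t n)) \<longlonglongrightarrow> l" "(\<lambda>n. F (y (t n)) - F xs) \<longlonglongrightarrow> 0"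
    using strict_mono_o[OF r(1) r'(1)] r'(2) LIMSEQ_subseq_LIMSEQ[OF r(2) r'(1)]
    by (auto simp: t_def comp_def)
  have sub0: "(\<lambda>n. d (t n)) \<longlonglongrightarrow> 0" if "summable (\<lambda>k. (d k)\<^sup>2)" for d :: "nat \<Rightarrow> real"
    using LIMSEQ_subseq_LIMSEQ[OF square_summable_tendsto_zero[OF that] t(1)] by (simp add: comp_def)
  have yl: "(\<lambda>n. y (t n)) \<longlonglongrightarrow> l"
  proof -
    have "(\<lambda>n. norm (z 1 (t n) - y (t n))) \<longlonglongrightarrow> 0"
      by (rule tendsto_sandwich[OF _ _ tendsto_const sub0[OF \<rho>_sq]]) (use z1 in auto)
    then have "(\<lambda>n. z 1 (t n) - y (t n)) \<longlonglongrightarrow> 0" by (rule tendsto_norm_zero_cancel)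
    from tendsto_diff[OF t(2) this] show ?thesis by simp
  qed
  have "l \<in> X"
    using y(1) by (intro closed_sequentially[OF X(1) _ yl]) simp
  have Fl: "F l \<le> F xs"
  proof -
    have "F l - F (y (t n)) \<le> real N * (C * dist (y (t n)) l)" for n
    proof -
      have "F l - F (y (t n)) = (\<Sum>i\<in>{1..N}. f i l - f i (y (t n)))"
        by (simp add: F_def sum_subtractf)
      also have "\<dots> \<le> (\<Sum>i\<in>{1..N}. C * dist (y (t n)) l)"
        by (intro sum_mono lip subsetD[OF X(2)] y(1) \<open>l \<in> X\<close>)
      finally show ?thesis by simp
    qed
    then have "F l - F xs \<le> real N * (C * dist (y (t n)) l) + (F (y (t n)) - F xs)" for n
      by (simp add: algebra_simps)
    moreover have "(\<lambda>n. real N * (C * dist (y (t n)) l) + (F (y (t n)) - F xs)) \<longlonglongrightarrow> real N * (C * dist l l) + 0"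
      by (intro tendsto_intros yl t(3))
    ultimately have "F l - F xs \<le> real N * (C * dist l l) + 0"
      by (intro LIMSEQ_le_const) auto
    then show ?thesis by simp
  qed
  have lopt: "\<And>y. y \<in> X \<Longrightarrow> F l \<le> F y"
    using Fl Fxs order_trans by blast
  \<comment> \<open>Since \<open>l\<close> is itself a minimiser, \<open>u l\<close> converges along
    the full sequence, so its limit can be read off the subsequence \<open>t\<close>.\<close>
  obtain m where m: "u l \<longlonglongrightarrow> m"
    using conv(1)[OF \<open>l \<in> X\<close> lopt] by (auto simp: convergent_def)
  have "(\<lambda>n. u l (t n)) \<longlonglongrightarrow> (\<Sum>i\<in>{1..N}. (norm (l - l))\<^sup>2)"
    unfolding u_def
  proof (intro tendsto_intros)
    fix i assume i: "i \<in> {1..N}"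
    have "(\<lambda>n. z i (t n) - z 1 (t n)) \<longlonglongrightarrow> 0"
      by (rule tendsto_norm_zero_cancel) (rule sub0[OF cons[OF i one]])
    from tendsto_add[OF this t(2)] show "(\<lambda>n. z i (t n)) \<longlonglongrightarrow> l" by simp
  qed
  then have "(\<lambda>n. u l (t n)) \<longlonglongrightarrow> 0" by simp
  with LIMSEQ_subseq_LIMSEQ[OF m t(1)] have "m = 0"
    using LIMSEQ_unique by (fastforce simp: comp_def)
  have "z i \<longlonglongrightarrow> l" if i: "i \<in> {1..N}" for i
  proof -
    have "(\<lambda>k. (norm (z i k - l))\<^sup>2) \<longlonglongrightarrow> 0"
    proof (rule tendsto_sandwich[OF _ _ tendsto_const])
      show "\<forall>\<^sub>F k in sequentially. (norm (z i k - l))\<^sup>2 \<le> u l k"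
        unfolding u_def using i by (intro always_eventually allI member_le_sum) auto
    qed (use m \<open>m = 0\<close> in auto)
    then have "(\<lambda>k. norm (z i k - l)) \<longlonglongrightarrow> 0" by simp
    then show ?thesis by (rule Lim_null[THEN iffD2, OF tendsto_norm_zero_cancel])
  qed
  moreover have "is_arg_min F (\<lambda>y. y \<in> X) l"
    using \<open>l \<in> X\<close> lopt by (simp add: is_arg_min_linorder)
  ultimately show ?thesis using that by blast
qed

section \<open>Square-summable distances to the feasible set\<close>

lemma space_history [simp]: "space (history M N x \<omega> k) = space M"
  by (simp add: history_def initial_events_def sample_events_def space_measure_of_conv)

lemma sets_history:
  "sets (history M N x \<omega> k) =
    sigma_sets (space M) (initial_events M N x \<union> sample_events M N \<omega> {1..k})"
  unfolding history_def
  by (rule sets_measure_of) (auto simp: initial_events_def sample_events_def)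

lemma sets_history_mono: "k \<le> l \<Longrightarrow> sets (history M N x \<omega> k) \<subseteq> sets (history M N x \<omega> l)"
  unfolding sets_history by (intro sigma_sets_mono') (force simp: sample_events_def)

lemma measurable_history_mono:
  "h \<in> measurable (history M N x \<omega> k) L \<Longrightarrow> k \<le> l \<Longrightarrow> h \<in> measurable (history M N x \<omega> l) L"
  using measurable_mono[of L L "history M N x \<omega> k" "history M N x \<omega> l"] sets_history_mono
  by fastforce

lemma measurable_initial_history:
  fixes x :: "nat \<Rightarrow> nat \<Rightarrow> 'p \<Rightarrow> 'a::topological_space"
  assumes "i \<in> {1..N}"
  shows "x i 0 \<in> borel_measurable (history M N x \<omega> k)"
proof (rule measurableI)
  fix A :: "'a set" assume "A \<in> sets borel"
  then have "x i 0 -` A \<inter> space M \<in> initial_events M N x"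
    using assms unfolding initial_events_def by blast
  then show "x i 0 -` A \<inter> space (history M N x \<omega> k) \<in> sets (history M N x \<omega> k)"
    by (simp add: sets_history sigma_sets.Basic)
qed simp

lemma measurable_sample_history:
  assumes "i \<in> {1..N}" "1 \<le> t" "t \<le> k"
  shows "\<omega> i t \<in> measurable (history M N x \<omega> k) (count_space UNIV)"
proof (rule measurableI)
  fix A
  have "\<omega> i t -` A \<inter> space M \<in> sample_events M N \<omega> {1..k}"
    using assms unfolding sample_events_def by (intro UN_I[of i] UN_I[of t]) auto
  then show "\<omega> i t -` A \<inter> space (history M N x \<omega> k) \<in> sets (history M N x \<omega> k)"
    by (simp add: sets_history sigma_sets.Basic)
qed simp

section \<open>Independence of the next sample from the past\<close>

context prob_space
begin

lemma subalgebra_history: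
  assumes "sampling_condition M N \<Omega> P x \<omega>"
  shows "subalgebra M (history M N x \<omega> k)"
proof -
  have "indep_set (sigma_sets (space M) (initial_events M N x))
      (sigma_sets (space M) (sample_events M N \<omega> {1..}))"
    using assms by (simp add: sampling_condition_def)
  then have "sigma_sets (space M) (initial_events M N x) \<subseteq> events"
      "sigma_sets (space M) (sample_events M N \<omega> {1..}) \<subseteq> events"
    by (rule indep_setD_ev1, rule indep_setD_ev2)
  moreover have "sample_events M N \<omega> {1..k} \<subseteq> sample_events M N \<omega> {1..}"
    by (force simp: sample_events_def)
  ultimately have "initial_events M N x \<union> sample_events M N \<omega> {1..k} \<subseteq> events"
    by (blast intro: sigma_sets.Basic)
  then show ?thesis
    unfolding subalgebra_def sets_history by (simp add: sets.sigma_sets_subset)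
qed

text \<open>Independence of the initial data from the samples and of the samples among themselves is
  merged into one independent family. Its members are then grouped: those generating the history
  against the single next sample.\<close>

lemma indep_history_sample:
  assumes sc: "sampling_condition M N \<Omega> P x \<omega>" and i: "i \<in> {1..N}"
  shows "indep_set (sets (history M N x \<omega> k))
    (sigma_sets (space M) {\<omega> i (Suc k) -` A \<inter> space M | A. True})"
proof -
  let ?S = "\<lambda>p. {\<omega> (fst p) (snd p) -` A \<inter> space M | A. True}"
  let ?I = "{1..N} \<times> {1::nat..}"
  let ?init = "sigma_sets (space M) (initial_events M N x)"
  let ?samp = "sigma_sets (space M) (sample_events M N \<omega> {1..})"
  \<comment> \<open>The index \<open>None\<close> stands for the initial data,
    \<open>Some (i, t)\<close> for the sample of agent \<open>i\<close> at time
    \<open>t\<close>.\<close>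
  define F where "F = case_option ?init ?S"
  have indep0: "indep_set ?init ?samp" and "indep_vars (\<lambda>_. count_space UNIV) (\<lambda>(i, k). \<omega> i k) ?I"
    using sc unfolding sampling_condition_def by blast+
  then have indepS: "indep_sets ?S ?I"
    unfolding indep_vars_def2 by (simp add: case_prod_unfold)
  have samp_Pow: "sample_events M N \<omega> {1..} \<subseteq> Pow (space M)"
    by (auto simp: sample_events_def)
  have "indep_sets F (insert None (Some ` ?I))"
  proof (rule indep_setsI)
    fix j assume j: "j \<in> insert None (Some ` ?I)"
    show "F j \<subseteq> events"
    proof (cases j)
      case None
      then show ?thesis using indep_setD_ev1[OF indep0] by (simp add: F_def)
    next
      case (Some p)
      with j have "?S p \<subseteq> events" using indepS unfolding indep_sets_def by blast
      with Some show ?thesis by (simp add: F_def)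
    qed
  next
    fix A J assume J: "J \<noteq> {}" "J \<subseteq> insert None (Some ` ?I)" "finite J" "\<forall>j\<in>J. A j \<in> F j"
    define J' where "J' = {j. Some j \<in> J}"
    have J': "finite J'" "J' \<subseteq> ?I" "\<forall>j\<in>J'. A (Some j) \<in> ?S j"
      using J finite_vimageI[of J Some] by (auto simp: J'_def vimage_def F_def split: option.splits)
    have prodS: "prob (\<Inter>j\<in>J'. A (Some j)) = (\<Prod>j\<in>J'. prob (A (Some j)))" if "J' \<noteq> {}"
      using indep_setsD[OF indepS J'(2) that J'(1), of "\<lambda>j. A (Some j)"] J'(3) by simp
    show "prob (\<Inter>j\<in>J. A j) = (\<Prod>j\<in>J. prob (A j))"
    proof (cases "None \<in> J")
      case False
      then have "J = Some ` J'"
        using J(2) by (auto simp: J'_def image_iff)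
      with J(1) prodS show ?thesis by (simp add: prod.reindex)
    next
      case True
      then have JJ: "J = insert None (Some ` J')"
        using J(2) by (auto simp: J'_def image_iff)
      \<comment> \<open>The finite intersection of the sample events lies in the sigma-algebra of
        all samples. So the initial event splits off first, and the samples factor
        afterwards.\<close>
      have A0: "A None \<in> ?init" using J(4) True by (auto simp: F_def)
      show ?thesis
      proof (cases "J' = {}")
        case False
        interpret sigma_algebra "space M" ?samp
          by (rule sigma_algebra_sigma_sets[OF samp_Pow])
        have "A (Some j) \<in> ?samp" if "j \<in> J'" for j
        proof (rule sigma_sets.Basic)
          show "A (Some j) \<in> sample_events M N \<omega> {1..}"
            using J'(2,3) that unfolding sample_events_def by fastforce
        qed
        then have "(\<Inter>j\<in>J'. A (Some j)) \<in> ?samp"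
          using J'(1) False by (intro finite_INT) auto
        from indep_setD[OF indep0 A0 this] prodS[OF False] show ?thesis
          using J'(1) by (simp add: JJ prod.reindex)
      qed (simp add: JJ)
    qed
  qed
  define L where "L b = (if b then insert None (Some ` ({1..N} \<times> {1..k})) else {Some (i, Suc k)})" for b
  have "indep_sets (\<lambda>b. sigma_sets (space M) (\<Union>j\<in>L b. F j)) UNIV"
  proof (rule indep_sets_collect_sigma)
    show "indep_sets F (\<Union>b\<in>UNIV. L b)"
      by (rule indep_sets_mono_index[OF _ \<open>indep_sets F (insert None (Some ` ?I))\<close>])
         (use i in \<open>auto simp: L_def split: if_splits\<close>)
    have stS: "Int_stable (?S p)" for p
    proof (rule Int_stableI)
      fix a b assume "a \<in> ?S p" "b \<in> ?S p"
      then obtain A B where "a = \<omega> (fst p) (snd p) -` A \<inter> space M"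
          "b = \<omega> (fst p) (snd p) -` B \<inter> space M" by blast
      then have "a \<inter> b = \<omega> (fst p) (snd p) -` (A \<inter> B) \<inter> space M" by auto
      then show "a \<inter> b \<in> ?S p" by blast
    qed
    have stI: "Int_stable ?init"
    proof -
      interpret sigma_algebra "space M" ?init
        by (rule sigma_algebra_sigma_sets) (auto simp: initial_events_def)
      show ?thesis by (auto simp: Int_stable_def)
    qed
    show "Int_stable (F j)" for j
      using stS stI by (cases j) (auto simp: F_def)
    show "disjoint_family_on L UNIV"
      by (auto simp: disjoint_family_on_def L_def)
  qed
  then show ?thesis
    unfolding indep_set_def
  proof (rule indep_sets_mono_sets)
    fix b :: bool
    show "(case b of True \<Rightarrow> sets (history M N x \<omega> k)
        | False \<Rightarrow> sigma_sets (space M) {\<omega> i (Suc k) -` A \<inter> space M | A. True})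
      \<subseteq> sigma_sets (space M) (\<Union>j\<in>L b. F j)"
    proof (cases b)
      case True
      have "sample_events M N \<omega> {1..k} \<subseteq> (\<Union>j\<in>L True. F j)"
        unfolding sample_events_def L_def F_def by force
      moreover have "initial_events M N x \<subseteq> (\<Union>j\<in>L True. F j)"
        unfolding L_def F_def by (auto intro: sigma_sets.Basic)
      ultimately show ?thesis
        using True by (auto simp: sets_history intro!: sigma_sets_mono' del: subsetI)
    qed (auto simp: L_def F_def)
  qed
qed

text \<open>The indicator of one sample value is independent of \<open>Z\<close>. As each
  \<open>\<Omega> i\<close> is finite, summing over its values replaces a conditional expectation
  given the history.\<close>

lemma expectation_history_sample:
  assumes sc: "sampling_condition M N \<Omega> P x \<omega>" and i: "i \<in> {1..N}"
    and Z: "Z \<in> borel_measurable (history M N x \<omega> k)" "integrable M Z"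
  shows "expectation (\<lambda>\<xi>. Z \<xi> * indicat_real {w} (\<omega> i (Suc k) \<xi>)) = expectation Z * pmf (P i) w"
    and "integrable M (\<lambda>\<xi>. Z \<xi> * indicat_real {w} (\<omega> i (Suc k) \<xi>))"
proof -
  let ?Y = "\<lambda>\<xi>. indicat_real {w} (\<omega> i (Suc k) \<xi>)"
  have distr: "distr M (count_space UNIV) (\<omega> i (Suc k)) = measure_pmf (P i)"
    and indep: "indep_vars (\<lambda>_. count_space UNIV) (\<lambda>(i, k). \<omega> i k) ({1..N} \<times> {1..})"
    using sc i unfolding sampling_condition_def by simp_all
  have om: "\<omega> i (Suc k) \<in> measurable M (count_space UNIV)"
    using i indep unfolding indep_vars_def2 by auto
  have iv: "indep_var borel Z borel ?Y"
    unfolding indep_var_eq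
  proof (intro conjI)
    show "random_variable borel Z"
      using measurable_from_subalg[OF subalgebra_history[OF sc] Z(1)] .
    show "random_variable borel ?Y"
      using om by (rule measurable_compose) simp
    have 1: "sigma_sets (space M) {Z -` A \<inter> space M | A. A \<in> sets borel} \<subseteq> sets (history M N x \<omega> k)"
    proof -
      have "{Z -` A \<inter> space M | A. A \<in> sets borel} \<subseteq> sets (history M N x \<omega> k)"
        using measurable_sets[OF Z(1)] by auto
      from sets.sigma_sets_subset[OF this] show ?thesis by simp
    qed
    have 2: "sigma_sets (space M) {?Y -` A \<inter> space M | A. A \<in> sets borel}
        \<subseteq> sigma_sets (space M) {\<omega> i (Suc k) -` A \<inter> space M | A. True}"
    proof (rule sigma_sets_mono', safe)
      fix A :: "real set"
      show "\<exists>B. ?Y -` A \<inter> space M = \<omega> i (Suc k) -` B \<inter> space M \<and> True"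
        \<comment> \<open>An event about the indicator is an event about the sample: that its value
          lies in the preimage of \<open>A\<close> under the indicator.\<close>
        by (rule exI[of _ "indicat_real {w} -` A"]) auto
    qed
    show "indep_set (sigma_sets (space M) {Z -` A \<inter> space M | A. A \<in> sets borel})
        (sigma_sets (space M) {?Y -` A \<inter> space M | A. A \<in> sets borel})"
      using indep_history_sample[OF sc i, of k] 1 2 unfolding indep_sets2_eq by blast
  qed
  have Y: "integrable M ?Y"
    using om by (intro integrable_const_bound[where B = 1]) (auto simp: indicator_def)
  have EY: "expectation ?Y = pmf (P i) w"
  proof -
    have "expectation ?Y = integral\<^sup>L (distr M (count_space UNIV) (\<omega> i (Suc k))) (indicat_real {w})"
      using om by (subst integral_distr) auto
    also have "\<dots> = pmf (P i) w"
      by (simp add: distr measure_pmf_single)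
    finally show ?thesis .
  qed
  show "expectation (\<lambda>\<xi>. Z \<xi> * ?Y \<xi>) = expectation Z * pmf (P i) w"
    using indep_var_lebesgue_integral[OF iv Z(2) Y] by (simp only: EY)
  show "integrable M (\<lambda>\<xi>. Z \<xi> * ?Y \<xi>)"
    by (rule indep_var_integrable[OF iv Z(2) Y])
qed

end

section \<open>From expectations to almost sure summability\<close>

text \<open>By monotone convergence the series has finite expectation, hence is finite almost
  everywhere.\<close>

lemma AE_summable_if_summable_integral:
  fixes h :: "nat \<Rightarrow> 'a \<Rightarrow> real"
  assumes "\<And>k. integrable M (h k)" "\<And>k \<xi>. 0 \<le> h k \<xi>" "summable (\<lambda>k. integral\<^sup>L M (h k))"
  shows "AE \<xi> in M. summable (\<lambda>k. h k \<xi>)"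
proof -
  have [measurable]: "h k \<in> borel_measurable M" for k using assms(1) by auto
  have "(\<integral>\<^sup>+\<xi>. (\<Sum>k. ennreal (h k \<xi>)) \<partial>M) = (\<Sum>k. \<integral>\<^sup>+\<xi>. ennreal (h k \<xi>) \<partial>M)"
    by (rule nn_integral_suminf) simp
  also have "\<dots> = (\<Sum>k. ennreal (integral\<^sup>L M (h k)))"
    using assms by (simp add: nn_integral_eq_integral)
  also have "\<dots> \<noteq> \<infinity>"
    using assms by (simp add: suminf_ennreal2)
  finally have "AE \<xi> in M. (\<Sum>k. ennreal (h k \<xi>)) \<noteq> \<infinity>"
    by (intro nn_integral_noteq_infinite) auto
  then show ?thesis
    by eventually_elim (use assms(2) in \<open>auto intro: summable_suminf_not_top\<close>)
qed

text \<open>Continuity is available on \<open>S\<close> only. Multiplying by the indicator of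
  \<open>S\<close> gives a Borel function and changes nothing at the values of
  \<open>u\<close>.\<close>

lemma measurable_continuous_on_values:
  fixes h :: "'a::topological_space \<Rightarrow> 'b::real_normed_vector"
  assumes "continuous_on S h" "S \<in> sets borel" "u \<in> borel_measurable L"
    and "\<And>\<xi>. \<xi> \<in> space L \<Longrightarrow> u \<xi> \<in> S"
  shows "(\<lambda>\<xi>. h (u \<xi>)) \<in> borel_measurable L"
proof -
  have "(\<lambda>\<xi>. indicator S (u \<xi>) *\<^sub>R h (u \<xi>)) \<in> borel_measurable L"
    using measurable_compose[OF assms(3) borel_measurable_continuous_on_indicator[OF assms(2,1)]] .
  then show ?thesis
    by (rule measurable_cong[THEN iffD1, rotated]) (simp add: assms(4))
qed

lemma measurable_infdist:
  fixes u :: "'p \<Rightarrow> 'a::euclidean_space"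
  shows "u \<in> borel_measurable L \<Longrightarrow> (\<lambda>\<xi>. infdist (u \<xi>) X) \<in> borel_measurable L"
  by (rule measurable_compose[OF _ borel_measurable_continuous_onI]) (auto intro: continuous_intros)

text \<open>The probabilistic half of the argument. With the shifted indices, \<open>v i k\<close>
  is known from the history at time \<open>k\<close>, whereas \<open>\<omega> i (Suc k)\<close> is
  independent of it; hence regularity can be averaged at the random point
  \<open>v i k\<close>.\<close>

lemma (in prob_space) AE_summable_infdist:
  fixes z q v :: "nat \<Rightarrow> nat \<Rightarrow> 'a \<Rightarrow> 'b::euclidean_space" and g :: "'b \<Rightarrow> 'w \<Rightarrow> real"
    and a :: "nat \<Rightarrow> real" and N :: nat and X0 :: "'b set" and \<Omega> :: "nat \<Rightarrow> 'w set"
  defines "X \<equiv> feasible_set N X0 g \<Omega>"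
  assumes sc: "sampling_condition M N \<Omega> P x \<omega>" and reg: "regularity_condition N X0 g \<Omega> P"
    and w: "weight_condition N E W"
    and X: "closed X" "convex X" "X \<noteq> {}" and X0: "closed X0" and C: "0 \<le> C" "0 < G"
    and fin: "\<And>i. i \<in> {1..N} \<Longrightarrow> finite (\<Omega> i)"
    and g_cont: "\<And>i w. i \<in> {1..N} \<Longrightarrow> w \<in> \<Omega> i \<Longrightarrow> continuous_on X0 (\<lambda>y. gplus g y w)"
    and g_le: "\<And>i w y. i \<in> {1..N} \<Longrightarrow> w \<in> \<Omega> i \<Longrightarrow> y \<in> X0 \<Longrightarrow> gplus g y w \<le> G * infdist y X"
    and a: "\<And>k. 0 \<le> a k" "summable (\<lambda>k. (a k)\<^sup>2)"
    and meas: "\<And>i k. i \<in> {1..N} \<Longrightarrow> z i k \<in> borel_measurable (history M N x \<omega> k)"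
      "\<And>i k. i \<in> {1..N} \<Longrightarrow> v i k \<in> borel_measurable (history M N x \<omega> k)"
    and v_X0: "\<And>i k \<xi>. i \<in> {1..N} \<Longrightarrow> \<xi> \<in> space M \<Longrightarrow> v i k \<xi> \<in> X0"
    and q: "\<And>i k \<xi>. i \<in> {1..N} \<Longrightarrow> \<xi> \<in> space M \<Longrightarrow> q i k \<xi> = (\<Sum>j\<in>{1..N}. W (Suc k) i j *\<^sub>R z j k \<xi>)"
    and vq: "\<And>i k \<xi>. i \<in> {1..N} \<Longrightarrow> \<xi> \<in> space M \<Longrightarrow> norm (v i k \<xi> - q i k \<xi>) \<le> C * a k"
    and zv: "\<And>i k \<xi>. i \<in> {1..N} \<Longrightarrow> \<xi> \<in> space M \<Longrightarrow> infdist (z i (Suc k) \<xi>) X \<le> infdist (v i k \<xi>) X"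
    and desc: "\<And>i k \<xi>. i \<in> {1..N} \<Longrightarrow> \<xi> \<in> space M \<Longrightarrow>
      (infdist (z i (Suc k) \<xi>) X)\<^sup>2 + (gplus g (v i k \<xi>) (\<omega> i (Suc k) \<xi>) / G)\<^sup>2
        \<le> (infdist (q i k \<xi>) X)\<^sup>2 + 2 * (C * a k) * infdist (q i k \<xi>) X + (C * a k)\<^sup>2"
  shows "AE \<xi> in M. \<forall>i\<in>{1..N}. summable (\<lambda>k. (infdist (v i k \<xi>) X)\<^sup>2)"
proof -
  note subalg = subalgebra_history[OF sc]
  obtain y0 where y0: "y0 \<in> X" using X(3) by blast
  \<comment> \<open>One constant for all agents: the sum of the individual ones, plus 1 so that it
    is positive in every case.\<close>
  obtain c where c: "c > 0" "\<And>i y. i \<in> {1..N} \<Longrightarrow> y \<in> X0 \<Longrightarrow>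
      (infdist y X)\<^sup>2 \<le> c * measure_pmf.expectation (P i) (\<lambda>w. (gplus g y w)\<^sup>2)"
  proof -
    have "\<exists>c. \<forall>i\<in>{1..N}. c i > 0 \<and> (\<forall>y\<in>X0.
        (infdist y X)\<^sup>2 \<le> c i * measure_pmf.expectation (P i) (\<lambda>w. (gplus g y w)\<^sup>2))"
      using reg unfolding regularity_condition_def X_def by (intro bchoice) blast
    then obtain c where c: "\<And>i. i \<in> {1..N} \<Longrightarrow> c i > 0"
        "\<And>i y. i \<in> {1..N} \<Longrightarrow> y \<in> X0 \<Longrightarrow>
          (infdist y X)\<^sup>2 \<le> c i * measure_pmf.expectation (P i) (\<lambda>w. (gplus g y w)\<^sup>2)"
      by blast
    show ?thesis
    proof
      show "1 + (\<Sum>i\<in>{1..N}. c i) > 0" using c(1) by (intro add_pos_nonneg sum_nonneg) (auto intro: less_imp_le)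
      fix i y assume i: "i \<in> {1..N}" and y: "y \<in> X0"
      have "c i \<le> (\<Sum>i\<in>{1..N}. c i)"
        using i c(1) by (intro member_le_sum) (auto intro: less_imp_le)
      then have "c i * measure_pmf.expectation (P i) (\<lambda>w. (gplus g y w)\<^sup>2)
          \<le> (1 + (\<Sum>i\<in>{1..N}. c i)) * measure_pmf.expectation (P i) (\<lambda>w. (gplus g y w)\<^sup>2)"
        by (intro mult_right_mono integral_nonneg) auto
      with c(2)[OF i y] show "(infdist y X)\<^sup>2
          \<le> (1 + (\<Sum>i\<in>{1..N}. c i)) * measure_pmf.expectation (P i) (\<lambda>w. (gplus g y w)\<^sup>2)"
        by linarith
    qed
  qed
  define S where "S k \<xi> = (\<Sum>i\<in>{1..N}. (infdist (z i k \<xi>) X)\<^sup>2)" for k \<xi>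
  define V where "V k \<xi> = (\<Sum>i\<in>{1..N}. (infdist (v i k \<xi>) X)\<^sup>2)" for k \<xi>
  \<comment> \<open>By regularity the expected decrease is at least \<open>2 * \<kappa>\<close>
    times the expectation of \<open>V k\<close>. One half pays for the cross term below; the other
    half remains.\<close>
  define \<kappa> where "\<kappa> = 1 / (2 * c * G\<^sup>2)"
  have \<kappa>: "\<kappa> > 0" using c(1) C(2) by (simp add: \<kappa>_def)
  \<comment> \<open>In units of \<open>(C * a k)\<^sup>2\<close>, the 3 is the squared step plus
    twice the cost of replacing \<open>q\<close> by \<open>v\<close> in the cross term;
    \<open>1 / \<kappa>\<close> comes from splitting that cross term by Young's inequality.\<close>
  define K where "K = real N * (C\<^sup>2 * (3 + 1 / \<kappa>))"
  have K: "K \<ge> 0" using \<kappa> by (simp add: K_def)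
  define H where "H i k \<xi> = (gplus g (v i k \<xi>) (\<omega> i (Suc k) \<xi>))\<^sup>2" for i k \<xi>
  have step: "S (Suc k) \<xi> + (\<Sum>i\<in>{1..N}. H i k \<xi>) / G\<^sup>2 \<le> S k \<xi> + \<kappa> * V k \<xi> + K * (a k)\<^sup>2"
    if \<xi>: "\<xi> \<in> space M" for k \<xi>
  proof -
    have ineq: "(infdist (z i (Suc k) \<xi>) X)\<^sup>2 + H i k \<xi> / G\<^sup>2
        \<le> (infdist (q i k \<xi>) X)\<^sup>2 + \<kappa> * (infdist (v i k \<xi>) X)\<^sup>2 + C\<^sup>2 * (3 + 1 / \<kappa>) * (a k)\<^sup>2"
      if i: "i \<in> {1..N}" for i
    proof -
      have "infdist (q i k \<xi>) X \<le> infdist (v i k \<xi>) X + C * a k"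
        using infdist_triangle[of "q i k \<xi>" X "v i k \<xi>"] vq[OF i \<xi>, of k]
        by (simp add: dist_norm norm_minus_commute)
      then have "2 * (C * a k) * infdist (q i k \<xi>) X \<le> 2 * (C * a k) * (infdist (v i k \<xi>) X + C * a k)"
        using C a by (intro mult_left_mono) auto
      moreover have "2 * (C * a k) * infdist (v i k \<xi>) X \<le> \<kappa> * (infdist (v i k \<xi>) X)\<^sup>2 + (C * a k)\<^sup>2 / \<kappa>"
      proof -
        have "0 \<le> (sqrt \<kappa> * infdist (v i k \<xi>) X - C * a k / sqrt \<kappa>)\<^sup>2" by simp
        also have "\<dots> = \<kappa> * (infdist (v i k \<xi>) X)\<^sup>2 + (C * a k)\<^sup>2 / \<kappa> - 2 * (C * a k) * infdist (v i k \<xi>) X"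
          using \<kappa> by (simp add: power2_diff power_mult_distrib power_divide)
        finally show ?thesis by simp
      qed
      ultimately show ?thesis
        using desc[OF i \<xi>, of k]
        by (simp add: H_def power_divide power_mult_distrib algebra_simps power2_eq_square)
    qed
    have "(\<Sum>i\<in>{1..N}. (infdist (z i (Suc k) \<xi>) X)\<^sup>2 + H i k \<xi> / G\<^sup>2)
        \<le> (\<Sum>i\<in>{1..N}. (infdist (q i k \<xi>) X)\<^sup>2 + \<kappa> * (infdist (v i k \<xi>) X)\<^sup>2
            + C\<^sup>2 * (3 + 1 / \<kappa>) * (a k)\<^sup>2)"
      by (intro sum_mono ineq)
    then have "S (Suc k) \<xi> + (\<Sum>i\<in>{1..N}. H i k \<xi>) / G\<^sup>2
        \<le> (\<Sum>i\<in>{1..N}. (infdist (q i k \<xi>) X)\<^sup>2) + \<kappa> * V k \<xi> + K * (a k)\<^sup>2"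
      by (simp add: S_def V_def K_def sum.distrib mult.assoc flip: sum_distrib_left sum_divide_distrib)
    moreover have "(\<Sum>i\<in>{1..N}. (infdist (q i k \<xi>) X)\<^sup>2) \<le> S k \<xi>"
      unfolding S_def
    proof (rule sum_doubly_stochastic_power2_le[where w = "W (Suc k)"])
      fix i assume i: "i \<in> {1..N}"
      show "infdist (q i k \<xi>) X \<le> (\<Sum>j\<in>{1..N}. W (Suc k) i j * infdist (z j k \<xi>) X)"
        unfolding q[OF i \<xi>] using i by (intro infdist_weighted_sum_le X weight_conditionD[OF w]) auto
    qed (use weight_conditionD[OF w, of "Suc k"] infdist_nonneg in auto)
    ultimately show ?thesis by simp
  qed
  have S0: "0 \<le> S k \<xi>" and V0: "0 \<le> V k \<xi>" for k \<xi>
    by (auto simp: S_def V_def intro: sum_nonneg)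
  \<comment> \<open>These events are determined at time 0, so restricting to them keeps
    measurability with respect to every history.\<close>
  define A where "A R = {\<xi> \<in> space M. \<forall>i\<in>{1..N}. norm (z i 0 \<xi>) \<le> R}" for R :: real
  have A_sets: "A R \<in> sets (history M N x \<omega> k)" for R k
  proof -
    have "A R \<in> sets (history M N x \<omega> 0)"
    proof -
      have "{\<xi> \<in> space (history M N x \<omega> 0). norm (z i 0 \<xi>) \<le> R} \<in> sets (history M N x \<omega> 0)"
        if "i \<in> {1..N}" for i
        using meas(1)[OF that, of 0] by measurable
      then have "{\<xi> \<in> space (history M N x \<omega> 0). \<forall>i\<in>{1..N}. norm (z i 0 \<xi>) \<le> R} \<in> sets (history M N x \<omega> 0)"
        by (intro sets.sets_Collect_finite_All) auto
      then show ?thesis by (simp add: A_def)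
    qed
    then show ?thesis using sets_history_mono[of 0 k] by blast
  qed
  have "AE \<xi> in M. summable (\<lambda>k. indicat_real (A R) \<xi> * V k \<xi>)" for R
  proof (rule AE_summable_if_summable_integral)
    let ?I = "indicat_real (A R)"
    \<comment> \<open>On \<open>A R\<close> all distances to \<open>X\<close> have a deterministic
      bound: mixing and the constraint step do not raise it, and the objective step adds at most
      \<open>C * a k\<close>.\<close>
    define B where "B k = R + norm y0 + C * (\<Sum>t<k. a t)" for k
    \<comment> \<open>The bound on \<open>z\<close> is a premise here because this fact is needed
      inside the induction that proves it.\<close>
    have vB: "infdist (v i k \<xi>) X \<le> B k + C * a k"
      if zB: "\<And>i. i \<in> {1..N} \<Longrightarrow> infdist (z i k \<xi>) X \<le> B k" and i: "i \<in> {1..N}" and \<xi>: "\<xi> \<in> space M" for i k \<xi>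
    proof -
      have "infdist (q i k \<xi>) X \<le> (\<Sum>j\<in>{1..N}. W (Suc k) i j * infdist (z j k \<xi>) X)"
        unfolding q[OF i \<xi>] using i by (intro infdist_weighted_sum_le X weight_conditionD[OF w]) auto
      also have "\<dots> \<le> (\<Sum>j\<in>{1..N}. W (Suc k) i j * B k)"
        using i by (intro sum_mono mult_left_mono zB weight_conditionD[OF w]) auto
      also have "\<dots> = B k"
        using weight_conditionD(2)[OF w, of "Suc k" i] i by (simp flip: sum_distrib_right)
      finally show ?thesis
        using infdist_triangle[of "v i k \<xi>" X "q i k \<xi>"] vq[OF i \<xi>, of k] by (simp add: dist_norm)
    qed
    have zB: "infdist (z i k \<xi>) X \<le> B k" if "i \<in> {1..N}" "\<xi> \<in> A R" for i k \<xi>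
      using that(1)
    proof (induction k arbitrary: i)
      case 0
      then have "norm (z i 0 \<xi>) \<le> R" using that(2) by (auto simp: A_def)
      then show ?case
        using infdist_le[OF y0, of "z i 0 \<xi>"] norm_triangle_ineq4[of "z i 0 \<xi>" y0]
        by (simp add: B_def dist_norm)
    next
      case (Suc k)
      have \<xi>: "\<xi> \<in> space M" using that(2) by (simp add: A_def)
      show ?case
        using zv[OF Suc.prems \<xi>, of k] vB[OF Suc.IH Suc.prems \<xi>] by (simp add: B_def algebra_simps)
    qed
    have vB': "infdist (v i k \<xi>) X \<le> B k + C * a k" if "i \<in> {1..N}" "\<xi> \<in> A R" for i k \<xi>
      using vB[OF zB[OF _ that(2)] that(1)] that(2) by (simp add: A_def)
    have I_meas: "?I \<in> borel_measurable (history M N x \<omega> k)" for k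
      using A_sets by (intro borel_measurable_indicator)
    have int_I: "integrable M (\<lambda>\<xi>. ?I \<xi> * h \<xi>)"
      if "h \<in> borel_measurable (history M N x \<omega> k)" "\<And>\<xi>. \<xi> \<in> A R \<Longrightarrow> \<bar>h \<xi>\<bar> \<le> b" "0 \<le> b" for h k b
    proof (rule integrable_const_bound[where B = b])
      show "AE \<xi> in M. norm (?I \<xi> * h \<xi>) \<le> b" using that(2,3) by (auto simp: indicator_def)
      show "(\<lambda>\<xi>. ?I \<xi> * h \<xi>) \<in> borel_measurable M"
        by (rule measurable_from_subalg[OF subalg borel_measurable_times[OF I_meas that(1)]])
    qed
    have int_z: "integrable M (\<lambda>\<xi>. ?I \<xi> * (infdist (z i k \<xi>) X)\<^sup>2)" if i: "i \<in> {1..N}" for i k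
    proof (rule int_I)
      show "(\<lambda>\<xi>. (infdist (z i k \<xi>) X)\<^sup>2) \<in> borel_measurable (history M N x \<omega> k)"
        by (intro borel_measurable_power measurable_infdist meas i)
      show "\<bar>(infdist (z i k \<xi>) X)\<^sup>2\<bar> \<le> (B k)\<^sup>2" if "\<xi> \<in> A R" for \<xi>
        by (simp add: power_mono[OF zB[OF i that] infdist_nonneg])
      show "0 \<le> (B k)\<^sup>2" by simp
    qed
    have int_v: "integrable M (\<lambda>\<xi>. ?I \<xi> * (infdist (v i k \<xi>) X)\<^sup>2)" if i: "i \<in> {1..N}" for i k
    proof (rule int_I)
      show "(\<lambda>\<xi>. (infdist (v i k \<xi>) X)\<^sup>2) \<in> borel_measurable (history M N x \<omega> k)"
        by (intro borel_measurable_power measurable_infdist meas i)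
      show "\<bar>(infdist (v i k \<xi>) X)\<^sup>2\<bar> \<le> (B k + C * a k)\<^sup>2" if "\<xi> \<in> A R" for \<xi>
        by (simp add: power_mono[OF vB'[OF i that] infdist_nonneg])
      show "0 \<le> (B k + C * a k)\<^sup>2" by simp
    qed
    have int_S: "integrable M (\<lambda>\<xi>. ?I \<xi> * S k \<xi>)" for k
      unfolding S_def sum_distrib_left by (intro Bochner_Integration.integrable_sum int_z)
    have int_V: "integrable M (\<lambda>\<xi>. ?I \<xi> * V k \<xi>)" for k
      unfolding V_def sum_distrib_left by (intro Bochner_Integration.integrable_sum int_v)
    have H_ge: "integrable M (\<lambda>\<xi>. ?I \<xi> * H i k \<xi>)"
      "expectation (\<lambda>\<xi>. ?I \<xi> * (infdist (v i k \<xi>) X)\<^sup>2) \<le> c * expectation (\<lambda>\<xi>. ?I \<xi> * H i k \<xi>)"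
      if i: "i \<in> {1..N}" for i k
    proof -
      define Z where "Z w \<xi> = ?I \<xi> * (gplus g (v i k \<xi>) w)\<^sup>2" for w \<xi>
      have Z_meas: "(\<lambda>\<xi>. (gplus g (v i k \<xi>) w)\<^sup>2) \<in> borel_measurable (history M N x \<omega> k)" if "w \<in> \<Omega> i" for w
        using X0 v_X0[OF i]
        by (intro borel_measurable_power measurable_continuous_on_values[OF g_cont[OF i that] _ meas(2)[OF i]]) auto
      have Z_int: "integrable M (Z w)" if ww: "w \<in> \<Omega> i" for w
        unfolding Z_def
      proof (rule int_I[OF Z_meas[OF ww]])
        show "0 \<le> (G * (B k + C * a k))\<^sup>2" by simp
        fix \<xi> assume \<xi>: "\<xi> \<in> A R"
        have "gplus g (v i k \<xi>) w \<le> G * infdist (v i k \<xi>) X"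
          using \<xi> by (intro g_le[OF i ww] v_X0[OF i]) (simp add: A_def)
        also have "\<dots> \<le> G * (B k + C * a k)" using vB'[OF i \<xi>] C by (intro mult_left_mono) auto
        finally show "\<bar>(gplus g (v i k \<xi>) w)\<^sup>2\<bar> \<le> (G * (B k + C * a k))\<^sup>2"
          by (simp add: power_mono)
      qed
      have Zm: "Z w \<in> borel_measurable (history M N x \<omega> k)" if "w \<in> \<Omega> i" for w
        unfolding Z_def by (intro borel_measurable_times I_meas Z_meas that)
      note ind = expectation_history_sample[OF sc i Zm Z_int]
      have om: "\<omega> i (Suc k) \<xi> \<in> \<Omega> i" if "\<xi> \<in> space M" for \<xi>
        using sc i that by (simp add: sampling_condition_def)
      \<comment> \<open>Exactly one summand survives, the one at the sampled value. Each summand is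
        a function of the past times an indicator of the next sample.\<close>
      have split: "?I \<xi> * H i k \<xi> = (\<Sum>w\<in>\<Omega> i. Z w \<xi> * indicat_real {w} (\<omega> i (Suc k) \<xi>))"
        if "\<xi> \<in> space M" for \<xi>
        using fin[OF i] om[OF that]
        by (simp add: Z_def H_def indicator_def of_bool_def if_distrib[of "\<lambda>t. _ * t"] sum.delta cong: if_cong)
      have "integrable M (\<lambda>\<xi>. \<Sum>w\<in>\<Omega> i. Z w \<xi> * indicat_real {w} (\<omega> i (Suc k) \<xi>))"
        by (intro Bochner_Integration.integrable_sum ind(2))
      then show "integrable M (\<lambda>\<xi>. ?I \<xi> * H i k \<xi>)"
        by (rule Bochner_Integration.integrable_cong[THEN iffD2, OF refl split, rotated])
      have "expectation (\<lambda>\<xi>. ?I \<xi> * H i k \<xi>)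
          = expectation (\<lambda>\<xi>. \<Sum>w\<in>\<Omega> i. Z w \<xi> * indicat_real {w} (\<omega> i (Suc k) \<xi>))"
        by (intro Bochner_Integration.integral_cong refl split)
      also have "\<dots> = (\<Sum>w\<in>\<Omega> i. expectation (Z w) * pmf (P i) w)"
        by (subst Bochner_Integration.integral_sum) (auto simp: ind)
      also have "\<dots> = expectation (\<lambda>\<xi>. \<Sum>w\<in>\<Omega> i. Z w \<xi> * pmf (P i) w)"
        by (subst Bochner_Integration.integral_sum) (auto simp: Z_int)
      finally have EH: "expectation (\<lambda>\<xi>. ?I \<xi> * H i k \<xi>) = expectation (\<lambda>\<xi>. \<Sum>w\<in>\<Omega> i. Z w \<xi> * pmf (P i) w)" .
      have "expectation (\<lambda>\<xi>. ?I \<xi> * (infdist (v i k \<xi>) X)\<^sup>2)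
          \<le> expectation (\<lambda>\<xi>. c * (\<Sum>w\<in>\<Omega> i. Z w \<xi> * pmf (P i) w))"
      proof (rule integral_mono)
        show "integrable M (\<lambda>\<xi>. ?I \<xi> * (infdist (v i k \<xi>) X)\<^sup>2)" by (rule int_v[OF i])
        show "integrable M (\<lambda>\<xi>. c * (\<Sum>w\<in>\<Omega> i. Z w \<xi> * pmf (P i) w))"
          by (intro integrable_mult_right Bochner_Integration.integrable_sum integrable_mult_left Z_int)
        fix \<xi> assume \<xi>: "\<xi> \<in> space M"
        have "set_pmf (P i) = \<Omega> i" using sc i by (simp add: sampling_condition_def)
        then have "measure_pmf.expectation (P i) (\<lambda>w. (gplus g (v i k \<xi>) w)\<^sup>2)
            = (\<Sum>w\<in>\<Omega> i. (gplus g (v i k \<xi>) w)\<^sup>2 * pmf (P i) w)"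
          using fin[OF i] by (intro integral_measure_pmf_real) auto
        then have "(infdist (v i k \<xi>) X)\<^sup>2 \<le> c * (\<Sum>w\<in>\<Omega> i. (gplus g (v i k \<xi>) w)\<^sup>2 * pmf (P i) w)"
          using c(2)[OF i v_X0[OF i \<xi>, of k]] by simp
        then show "?I \<xi> * (infdist (v i k \<xi>) X)\<^sup>2 \<le> c * (\<Sum>w\<in>\<Omega> i. Z w \<xi> * pmf (P i) w)"
          by (cases "\<xi> \<in> A R") (simp_all add: Z_def)
      qed
      then show "expectation (\<lambda>\<xi>. ?I \<xi> * (infdist (v i k \<xi>) X)\<^sup>2) \<le> c * expectation (\<lambda>\<xi>. ?I \<xi> * H i k \<xi>)"
        by (simp add: EH)
    qed
    have E_step: "expectation (\<lambda>\<xi>. ?I \<xi> * S (Suc k) \<xi>) + \<kappa> * expectation (\<lambda>\<xi>. ?I \<xi> * V k \<xi>)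
        \<le> expectation (\<lambda>\<xi>. ?I \<xi> * S k \<xi>) + K * (a k)\<^sup>2" for k
    proof -
      have int_H: "integrable M (\<lambda>\<xi>. \<Sum>i\<in>{1..N}. ?I \<xi> * H i k \<xi>)"
        by (intro Bochner_Integration.integrable_sum H_ge)
      have "expectation (\<lambda>\<xi>. ?I \<xi> * S (Suc k) \<xi> + (\<Sum>i\<in>{1..N}. ?I \<xi> * H i k \<xi>) / G\<^sup>2)
          \<le> expectation (\<lambda>\<xi>. ?I \<xi> * S k \<xi> + \<kappa> * (?I \<xi> * V k \<xi>) + K * (a k)\<^sup>2)"
      proof (rule integral_mono)
        show "integrable M (\<lambda>\<xi>. ?I \<xi> * S (Suc k) \<xi> + (\<Sum>i\<in>{1..N}. ?I \<xi> * H i k \<xi>) / G\<^sup>2)"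
          by (intro Bochner_Integration.integrable_add integrable_divide_zero int_S int_H)
        show "integrable M (\<lambda>\<xi>. ?I \<xi> * S k \<xi> + \<kappa> * (?I \<xi> * V k \<xi>) + K * (a k)\<^sup>2)"
          by (intro Bochner_Integration.integrable_add integrable_mult_right integrable_const int_S int_V)
        fix \<xi> assume "\<xi> \<in> space M"
        then show "?I \<xi> * S (Suc k) \<xi> + (\<Sum>i\<in>{1..N}. ?I \<xi> * H i k \<xi>) / G\<^sup>2
            \<le> ?I \<xi> * S k \<xi> + \<kappa> * (?I \<xi> * V k \<xi>) + K * (a k)\<^sup>2"
          \<comment> \<open>Outside \<open>A R\<close> only the nonnegative term with
            \<open>K\<close> is left.\<close>
          using step[of \<xi> k] K by (cases "\<xi> \<in> A R") auto
      qed
      also have "expectation (\<lambda>\<xi>. ?I \<xi> * S k \<xi> + \<kappa> * (?I \<xi> * V k \<xi>) + K * (a k)\<^sup>2)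
          = expectation (\<lambda>\<xi>. ?I \<xi> * S k \<xi>) + \<kappa> * expectation (\<lambda>\<xi>. ?I \<xi> * V k \<xi>) + K * (a k)\<^sup>2"
        using int_S int_V by (simp add: prob_space)
      also have "expectation (\<lambda>\<xi>. ?I \<xi> * S (Suc k) \<xi> + (\<Sum>i\<in>{1..N}. ?I \<xi> * H i k \<xi>) / G\<^sup>2)
          = expectation (\<lambda>\<xi>. ?I \<xi> * S (Suc k) \<xi>) + (\<Sum>i\<in>{1..N}. expectation (\<lambda>\<xi>. ?I \<xi> * H i k \<xi>)) / G\<^sup>2"
        by (simp only: Bochner_Integration.integral_add[OF int_S integrable_divide_zero[OF int_H]]
            integral_divide_zero Bochner_Integration.integral_sum[OF H_ge(1)])
      finally have le: "expectation (\<lambda>\<xi>. ?I \<xi> * S (Suc k) \<xi>) + (\<Sum>i\<in>{1..N}. expectation (\<lambda>\<xi>. ?I \<xi> * H i k \<xi>)) / G\<^sup>2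
          \<le> expectation (\<lambda>\<xi>. ?I \<xi> * S k \<xi>) + \<kappa> * expectation (\<lambda>\<xi>. ?I \<xi> * V k \<xi>) + K * (a k)\<^sup>2" .
      have "expectation (\<lambda>\<xi>. ?I \<xi> * V k \<xi>) = (\<Sum>i\<in>{1..N}. expectation (\<lambda>\<xi>. ?I \<xi> * (infdist (v i k \<xi>) X)\<^sup>2))"
        unfolding V_def sum_distrib_left by (intro Bochner_Integration.integral_sum int_v)
      also have "\<dots> \<le> c * (\<Sum>i\<in>{1..N}. expectation (\<lambda>\<xi>. ?I \<xi> * H i k \<xi>))"
        unfolding sum_distrib_left by (intro sum_mono H_ge(2))
      finally have "2 * \<kappa> * expectation (\<lambda>\<xi>. ?I \<xi> * V k \<xi>) \<le> (\<Sum>i\<in>{1..N}. expectation (\<lambda>\<xi>. ?I \<xi> * H i k \<xi>)) / G\<^sup>2"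
        using c(1) C(2) by (simp add: \<kappa>_def field_simps)
      with le show ?thesis by simp
    qed
    have "summable (\<lambda>k. \<kappa> * expectation (\<lambda>\<xi>. ?I \<xi> * V k \<xi>))"
    proof (rule perturbed_descent(2)[of "\<lambda>k. expectation (\<lambda>\<xi>. ?I \<xi> * S k \<xi>)" _ "\<lambda>k. K * (a k)\<^sup>2"])
      show "summable (\<lambda>k. K * (a k)\<^sup>2)" by (intro summable_mult a)
    qed (use E_step K \<kappa> S0 V0 in \<open>auto intro!: integral_nonneg_AE\<close>)
    then show "summable (\<lambda>k. expectation (\<lambda>\<xi>. ?I \<xi> * V k \<xi>))"
      using \<kappa> by (simp add: summable_cmult_iff)
    show "integrable M (\<lambda>\<xi>. ?I \<xi> * V k \<xi>)" for k by (rule int_V)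
    show "0 \<le> ?I \<xi> * V k \<xi>" for k \<xi> using V0 by simp
  qed
  then have "AE \<xi> in M. \<forall>R::nat. summable (\<lambda>k. indicat_real (A (real R)) \<xi> * V k \<xi>)"
    unfolding AE_all_countable by blast
  then show ?thesis
  proof (rule AE_mp, intro AE_I2 impI ballI)
    fix \<xi> i assume \<xi>: "\<xi> \<in> space M" and i: "i \<in> {1..N}"
      and sm: "\<forall>R::nat. summable (\<lambda>k. indicat_real (A (real R)) \<xi> * V k \<xi>)"
    \<comment> \<open>The events \<open>A R\<close> for natural \<open>R\<close> exhaust the space,
      so countably many null sets suffice.\<close>
    obtain R :: nat where R: "(\<Sum>i\<in>{1..N}. norm (z i 0 \<xi>)) \<le> real R"
      using real_arch_simple by blast
    have "norm (z j 0 \<xi>) \<le> real R" if "j \<in> {1..N}" for j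
      using R that by (intro order_trans[OF member_le_sum[of j "{1..N}" "\<lambda>i. norm (z i 0 \<xi>)"]]) auto
    then have "\<xi> \<in> A (real R)" using \<xi> by (simp add: A_def)
    then have "summable (\<lambda>k. V k \<xi>)" using sm[rule_format, of R] by simp
    then show "summable (\<lambda>k. (infdist (v i k \<xi>) X)\<^sup>2)"
    proof (rule summable_comparison_test'[of _ 0])
      fix k
      have "(infdist (v i k \<xi>) X)\<^sup>2 \<le> V k \<xi>"
        unfolding V_def using i by (intro member_le_sum) auto
      then show "norm ((infdist (v i k \<xi>) X)\<^sup>2) \<le> V k \<xi>" by simp
    qed
  qed
qed

section \<open>The algorithm\<close>

text \<open>All bounds compare with points of \<open>X\<close>, where the constraint holds. The move
  from \<open>v\<close> to \<open>z\<close> has length at most \<open>gplus g v w / norm e\<close>,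
  and the subgradient inequality bounds this by the distance from \<open>v\<close> to any such
  point.\<close>

lemma dap_step:
  fixes X0 :: "'a::euclidean_space set" and g :: "'a \<Rightarrow> 'w \<Rightarrow> real" and h :: "'a \<Rightarrow> real"
  assumes X0: "closed X0" "convex X0" and X: "closed X" "X \<noteq> {}" "X \<subseteq> X0"
    and q: "q \<in> X0" and a: "0 \<le> a" and s: "u \<in> subdifferential Dh h q" "norm u \<le> C" "X0 \<subseteq> Dh"
    and v: "v = closest_point X0 (q - a *\<^sub>R u)"
    and g: "X0 \<subseteq> D" "\<And>y. y \<in> X \<Longrightarrow> g y w \<le> 0"
    and e: "if gplus g v w > 0 then e \<in> subdifferential D (\<lambda>y. gplus g y w) v else e = e0" "e0 \<noteq> 0"
    and G: "0 < G" "\<And>e. e \<in> subdifferential D (\<lambda>y. gplus g y w) v \<Longrightarrow> norm e \<le> G"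
    and z: "z = closest_point X0 (v - (gplus g v w / (norm e)\<^sup>2) *\<^sub>R e)"
  shows "norm (v - q) \<le> C * a"
    and "norm (z - v) \<le> infdist v X"
    and "infdist z X \<le> infdist v X"
    and "(infdist z X)\<^sup>2 + (gplus g v w / G)\<^sup>2
      \<le> (infdist q X)\<^sup>2 + 2 * (C * a) * infdist q X + (C * a)\<^sup>2"
    and "\<And>y. y \<in> X \<Longrightarrow> (norm (z - y))\<^sup>2 \<le> (norm (q - y))\<^sup>2 - 2 * a * (h q - h y) + (C * a)\<^sup>2"
proof -
  have ne: "X0 \<noteq> {}" using q by auto
  have vX0: "v \<in> X0" unfolding v by (rule closest_point_in_set[OF X0(1) ne])
  have nonexp: "norm (closest_point X0 y - y') \<le> norm (y - y')" if "y' \<in> X0" for y y'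
    using closest_point_lipschitz[OF X0(2,1) ne, of y y'] closest_point_self[OF that] by (simp add: dist_norm)
  have au: "norm (a *\<^sub>R u) \<le> C * a"
    using s(2) a by (simp add: mult.commute[of C] mult_left_mono)
  have "norm (v - q) \<le> norm (a *\<^sub>R u)"
    using nonexp[OF q, of "q - a *\<^sub>R u"] by (simp add: v)
  with au show "norm (v - q) \<le> C * a" by linarith
  have pol: "(norm (z - y))\<^sup>2 \<le> (norm (v - y))\<^sup>2 - (gplus g v w / norm e)\<^sup>2"
      "e \<noteq> 0" "gplus g v w \<le> norm e * norm (v - y)" if "y \<in> X" for y
    using polyak_step_le[OF X0 subsetD[OF X(3) that] _ g(2)[OF that] e z] X(3) g(1) that by auto
  obtain y1 where y1: "y1 \<in> X" "infdist v X = dist v y1"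
    using infdist_attains_inf[OF X(1,2)] by blast
  have "norm (z - v) \<le> norm ((v - (gplus g v w / (norm e)\<^sup>2) *\<^sub>R e) - v)"
    unfolding z by (rule nonexp[OF vX0])
  also have "\<dots> = gplus g v w / norm e"
    using pol(2)[OF y1(1)] by (simp add: power2_eq_square)
  also have "\<dots> \<le> norm (v - y1)"
    using pol(2,3)[OF y1(1)] by (simp add: divide_le_eq mult.commute)
  finally show "norm (z - v) \<le> infdist v X"
    by (simp add: y1(2) dist_norm)
  have "(norm (z - y1))\<^sup>2 \<le> (norm (v - y1))\<^sup>2"
    using pol(1)[OF y1(1)] zero_le_power2[of "gplus g v w / norm e"] by linarith
  then have "norm (z - y1) \<le> norm (v - y1)" by (rule power2_le_imp_le) simp
  then show "infdist z X \<le> infdist v X"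
    using infdist_le[OF y1(1), of z] by (simp add: y1(2) dist_norm)
  have v_le: "(norm (v - y))\<^sup>2 \<le> (norm (q - y))\<^sup>2 - 2 * a * (u \<bullet> (q - y)) + (C * a)\<^sup>2" if "y \<in> X" for y
  proof -
    have "(norm (a *\<^sub>R u))\<^sup>2 \<le> (C * a)\<^sup>2" using au by (intro power_mono) auto
    then show ?thesis
      using projected_step_le[OF X0 subsetD[OF X(3) that], of q "a *\<^sub>R u"]
      by (simp add: v[symmetric] mult.assoc)
  qed
  show "(infdist z X)\<^sup>2 + (gplus g v w / G)\<^sup>2
      \<le> (infdist q X)\<^sup>2 + 2 * (C * a) * infdist q X + (C * a)\<^sup>2"
  proof -
    obtain y where y: "y \<in> X" "infdist q X = dist q y"
      using infdist_attains_inf[OF X(1,2)] by blast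
    \<comment> \<open>If the constraint holds at \<open>v\<close>, then \<open>e\<close> is the
      default direction and its norm need not be at most \<open>G\<close>, but both sides
      vanish.\<close>
    have "(gplus g v w / G)\<^sup>2 \<le> (gplus g v w / norm e)\<^sup>2"
    proof (cases "gplus g v w > 0")
      case True
      then have "norm e \<le> G" using e G(2) by auto
      then show ?thesis
        using pol(2)[OF y(1)] True G(1) by (intro power_mono divide_left_mono) auto
    next
      case False
      then have "gplus g v w = 0" using gplus_nonneg[of g v w] by linarith
      then show ?thesis by simp
    qed
    moreover have "(infdist z X)\<^sup>2 \<le> (norm (z - y))\<^sup>2"
      using infdist_le[OF y(1), of z] by (intro power_mono) (auto simp: dist_norm infdist_nonneg)
    \<comment> \<open>Here the objective gap has no known sign, so the inner product is bounded by
      Cauchy-Schwarz, with \<open>y\<close> the point of \<open>X\<close> nearest to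
      \<open>q\<close>.\<close>
    moreover have "- (2 * a * (u \<bullet> (q - y))) \<le> 2 * (C * a) * infdist q X"
    proof -
      have "- (u \<bullet> (q - y)) = (- u) \<bullet> (q - y)" by simp
      also have "\<dots> \<le> norm (- u) * norm (q - y)" by (rule norm_cauchy_schwarz)
      also have "\<dots> \<le> C * norm (q - y)" using s(2) by (intro mult_right_mono) auto
      finally have "2 * a * (- (u \<bullet> (q - y))) \<le> 2 * a * (C * norm (q - y))"
        using a by (intro mult_left_mono) auto
      then show ?thesis by (simp add: y(2) dist_norm mult.assoc mult.left_commute[of a C])
    qed
    ultimately show ?thesis
      using pol(1)[OF y(1)] v_le[OF y(1)] by (simp add: y(2) dist_norm)
  qed
  show "(norm (z - y))\<^sup>2 \<le> (norm (q - y))\<^sup>2 - 2 * a * (h q - h y) + (C * a)\<^sup>2" if "y \<in> X" for y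
  proof -
    have "h q - h y \<le> u \<bullet> (q - y)"
      using s(1,3) X(3) that by (force simp: subdifferential_def inner_diff_right)
    then have "2 * a * (h q - h y) \<le> 2 * a * (u \<bullet> (q - y))"
      using a by (intro mult_left_mono) auto
    then show ?thesis
      using pol(1)[OF that] v_le[OF that] zero_le_power2[of "gplus g v w / norm e"] by linarith
  qed
qed

section \<open>Topological consequences of the convexity condition\<close>

lemma convexity_conditionD:
  assumes "convexity_condition N X0 Df f Dg g \<Omega>"
  shows "X0 \<noteq> {}" "closed X0" "convex X0"
    and "i \<in> {1..N} \<Longrightarrow> open (Df i)" "i \<in> {1..N} \<Longrightarrow> X0 \<subseteq> Df i"
      "i \<in> {1..N} \<Longrightarrow> convex_on (Df i) (f i)"
    and "i \<in> {1..N} \<Longrightarrow> w \<in> \<Omega> i \<Longrightarrow> open (Dg w)" "i \<in> {1..N} \<Longrightarrow> w \<in> \<Omega> i \<Longrightarrow> X0 \<subseteq> Dg w"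
      "i \<in> {1..N} \<Longrightarrow> w \<in> \<Omega> i \<Longrightarrow> convex_on (Dg w) (\<lambda>y. g y w)"
  using assms unfolding convexity_condition_def by blast+

lemma continuous_on_constraint:
  assumes "convexity_condition N X0 Df f Dg g \<Omega>" "i \<in> {1..N}" "w \<in> \<Omega> i"
  shows "continuous_on X0 (\<lambda>y. g y w)"
  using convex_on_continuous continuous_on_subset convexity_conditionD(7-9)[OF assms] by blast

lemma continuous_on_gplus:
  assumes "convexity_condition N X0 Df f Dg g \<Omega>" "i \<in> {1..N}" "w \<in> \<Omega> i"
  shows "continuous_on X0 (\<lambda>y. gplus g y w)"
  unfolding gplus_def by (intro continuous_intros continuous_on_constraint[OF assms])

text \<open>The functions \<open>g\<close> are controlled only near \<open>X0\<close>. Cutting every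
  constraint set down to \<open>X0\<close> makes each of them closed and convex.\<close>

lemma feasible_set_eq:
  "feasible_set N X0 g \<Omega> = X0 \<inter> (\<Inter>i\<in>{1..N}. \<Inter>w\<in>\<Omega> i. {y \<in> X0. g y w \<le> 0})"
  by (auto simp: feasible_set_def constraint_set_def)

lemma closed_feasible_set:
  assumes "convexity_condition N X0 Df f Dg g \<Omega>"
  shows "closed (feasible_set N X0 g \<Omega>)"
  unfolding feasible_set_eq
  by (intro closed_Int closed_INT ballI continuous_on_closed_Collect_le continuous_on_constraint[OF assms]
      continuous_on_const convexity_conditionD(2)[OF assms])

lemma convex_feasible_set:
  assumes "convexity_condition N X0 Df f Dg g \<Omega>"
  shows "convex (feasible_set N X0 g \<Omega>)"
  unfolding feasible_set_eq
proof (intro convex_Int convex_INT convexity_conditionD(3)[OF assms])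
  fix i w assume iw: "i \<in> {1..N}" "w \<in> \<Omega> i"
  have "convex_on X0 (\<lambda>y. g y w)"
    using convex_on_subset[OF convexity_conditionD(9,8)[OF assms iw] convexity_conditionD(3)[OF assms]] .
  then show "convex {y \<in> X0. g y w \<le> 0}"
    unfolding convex_def convex_on_def
    by (smt (verit) mem_Collect_eq mult_nonneg_nonpos)
qed

text \<open>It is a sublevel set of a function continuous on the closed feasible set. Closedness
  makes optimality of the limit a measurable event.\<close>

lemma closed_optimal_set:
  assumes cc: "convexity_condition N X0 Df f Dg g \<Omega>"
  shows "closed (optimal_set N X0 f g \<Omega>)"
proof (cases "optimal_set N X0 f g \<Omega> = {}")
  case False
  let ?X = "feasible_set N X0 g \<Omega>" and ?F = "\<lambda>y. \<Sum>i\<in>{1..N}. f i y"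
  obtain y0 where y0: "y0 \<in> optimal_set N X0 f g \<Omega>" using False by blast
  then have "optimal_set N X0 f g \<Omega> = {y \<in> ?X. ?F y \<le> ?F y0}"
    by (auto simp: optimal_set_def is_arg_min_linorder intro: order_trans)
  moreover have "continuous_on ?X ?F"
  proof (intro continuous_on_sum)
    fix i assume i: "i \<in> {1..N}"
    have "?X \<subseteq> X0" by (auto simp: feasible_set_def)
    then show "continuous_on ?X (f i)"
      using convex_on_continuous[OF convexity_conditionD(4)[OF cc i] convexity_conditionD(6)[OF cc i]] convexity_conditionD(5)[OF cc i]
      by (blast intro: continuous_on_subset)
  qed
  ultimately show ?thesis
    by (simp add: continuous_on_closed_Collect_le continuous_on_const closed_feasible_set[OF cc])
qed simp

section \<open>Measurability of the iterates\<close>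

text \<open>Induction over time: \<open>v i (Suc k)\<close> needs only the iterates and subgradients
  known at time \<open>k\<close>, while \<open>x i (Suc k)\<close> also uses the sample and the
  direction of time \<open>Suc k\<close>.\<close>

lemma measurable_dap_iterates:
  fixes X0 :: "'a::euclidean_space set"
  assumes cc: "convexity_condition N X0 Df f Dg g \<Omega>" and sc: "sampling_condition M N \<Omega> P x \<omega>"
    and dap: "dap_iterates M N X0 Df f Dg g W \<alpha> d0 \<omega> s d p v x"
    and fin: "\<And>i. i \<in> {1..N} \<Longrightarrow> finite (\<Omega> i)"
    and i: "i \<in> {1..N}"
  shows "x i k \<in> borel_measurable (history M N x \<omega> k)"
    and "v i (Suc k) \<in> borel_measurable (history M N x \<omega> k)"
proof -
  have Pi: "closest_point X0 \<in> borel_measurable borel"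
    using convexity_conditionD(1-3)[OF cc]
    by (intro borel_measurable_continuous_onI continuous_on_closest_point) auto
  have v: "v i (Suc k) \<in> borel_measurable (history M N x \<omega> k)"
    if x: "\<And>j. j \<in> {1..N} \<Longrightarrow> x j k \<in> borel_measurable (history M N x \<omega> k)" and i: "i \<in> {1..N}" for i k
  proof -
    have s: "s i (Suc k) \<in> borel_measurable (history M N x \<omega> k)"
      using dap i unfolding dap_iterates_def by fastforce
    have "(\<lambda>\<xi>. (\<Sum>j\<in>{1..N}. W (Suc k) i j *\<^sub>R x j k \<xi>) - \<alpha> (Suc k) *\<^sub>R s i (Suc k) \<xi>)
        \<in> borel_measurable (history M N x \<omega> k)"
      by (intro borel_measurable_diff borel_measurable_sum borel_measurable_scaleR borel_measurable_const x s)
    from measurable_compose[OF this Pi] show ?thesis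
    proof (rule measurable_cong[THEN iffD1, rotated])
      fix \<xi> assume "\<xi> \<in> space (history M N x \<omega> k)"
      then show "closest_point X0 ((\<Sum>j\<in>{1..N}. W (Suc k) i j *\<^sub>R x j k \<xi>) - \<alpha> (Suc k) *\<^sub>R s i (Suc k) \<xi>)
          = v i (Suc k) \<xi>"
        using dap i by (simp add: dap_iterates_def)
    qed
  qed
  have x: "\<forall>i\<in>{1..N}. x i k \<in> borel_measurable (history M N x \<omega> k)" for k
  proof (induction k)
    case 0
    then show ?case using measurable_initial_history by blast
  next
    case (Suc k)
    show ?case
    proof
      fix i assume i: "i \<in> {1..N}"
      let ?L = "history M N x \<omega> (Suc k)"
      have v_meas: "v i (Suc k) \<in> borel_measurable ?L"
        using measurable_history_mono[OF v] Suc i by simp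
      have d_meas: "d i (Suc k) \<in> borel_measurable ?L"
        using dap i unfolding dap_iterates_def by fastforce
      have om: "\<omega> i (Suc k) \<in> measurable ?L (count_space UNIV)"
        using i by (intro measurable_sample_history) auto
      have v_X0: "v i (Suc k) \<xi> \<in> X0" if "\<xi> \<in> space M" for \<xi>
        using dap i that closest_point_in_set[OF convexity_conditionD(2,1)[OF cc]]
        by (simp add: dap_iterates_def)
      \<comment> \<open>The constraint value at a random point and a random index is written as a
        finite sum over the index, each term measurable by continuity on \<open>X0\<close>.\<close>
      define \<gamma> where "\<gamma> \<xi> = (\<Sum>w\<in>\<Omega> i. gplus g (v i (Suc k) \<xi>) w * indicat_real {w} (\<omega> i (Suc k) \<xi>))" for \<xi>
      have "\<gamma> \<in> borel_measurable ?L"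
        unfolding \<gamma>_def
      proof (intro borel_measurable_sum borel_measurable_times)
        fix w assume w: "w \<in> \<Omega> i"
        show "(\<lambda>\<xi>. gplus g (v i (Suc k) \<xi>) w) \<in> borel_measurable ?L"
          using convexity_conditionD(2)[OF cc] v_X0
          by (intro measurable_continuous_on_values[OF continuous_on_gplus[OF cc i w] _ v_meas]) auto
        show "(\<lambda>\<xi>. indicat_real {w} (\<omega> i (Suc k) \<xi>)) \<in> borel_measurable ?L"
          using om by (rule measurable_compose) simp
      qed
      then have "(\<lambda>\<xi>. v i (Suc k) \<xi> - (\<gamma> \<xi> / (norm (d i (Suc k) \<xi>))\<^sup>2) *\<^sub>R d i (Suc k) \<xi>) \<in> borel_measurable ?L"
        by (intro borel_measurable_diff borel_measurable_scaleR borel_measurable_divide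
            borel_measurable_power measurable_compose[OF d_meas borel_measurable_norm] v_meas d_meas)
      from measurable_compose[OF this Pi] show "x i (Suc k) \<in> borel_measurable ?L"
      proof (rule measurable_cong[THEN iffD1, rotated])
        fix \<xi> assume "\<xi> \<in> space ?L"
        then have \<xi>: "\<xi> \<in> space M" by simp
        then have "\<omega> i (Suc k) \<xi> \<in> \<Omega> i" using sc i by (simp add: sampling_condition_def)
        then have "\<gamma> \<xi> = gplus g (v i (Suc k) \<xi>) (\<omega> i (Suc k) \<xi>)"
          using fin[OF i]
          by (simp add: \<gamma>_def indicator_def of_bool_def if_distrib[of "\<lambda>t. _ * t"] sum.delta cong: if_cong)
        then show "closest_point X0 (v i (Suc k) \<xi> - (\<gamma> \<xi> / (norm (d i (Suc k) \<xi>))\<^sup>2) *\<^sub>R d i (Suc k) \<xi>)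
            = x i (Suc k) \<xi>"
          using dap i \<xi> by (simp add: dap_iterates_def)
      qed
    qed
  qed
  show "x i k \<in> borel_measurable (history M N x \<omega> k)"
    and "v i (Suc k) \<in> borel_measurable (history M N x \<omega> k)"
    using x v i by auto
qed

section \<open>Almost sure convergence of the algorithm\<close>

theorem proposition1:
  fixes M :: "'p measure"
    and N :: nat
    and E :: "nat \<Rightarrow> (nat \<times> nat) set"
    and W :: "nat \<Rightarrow> nat \<Rightarrow> nat \<Rightarrow> real"
    and X0 :: "(real ^ 'n) set"
    and Df :: "nat \<Rightarrow> (real ^ 'n) set"
    and f :: "nat \<Rightarrow> real ^ 'n \<Rightarrow> real"
    and \<Omega> :: "nat \<Rightarrow> 'w set"
    and Dg :: "'w \<Rightarrow> (real ^ 'n) set"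
    and g :: "real ^ 'n \<Rightarrow> 'w \<Rightarrow> real"
    and P :: "nat \<Rightarrow> 'w pmf"
    and \<alpha> :: "nat \<Rightarrow> real"
    and d0 :: "nat \<Rightarrow> real ^ 'n"
    and \<omega> :: "nat \<Rightarrow> nat \<Rightarrow> 'p \<Rightarrow> 'w"
    and s d p v x :: "nat \<Rightarrow> nat \<Rightarrow> 'p \<Rightarrow> real ^ 'n"
  assumes "prob_space M"
    and "\<And>k. k \<ge> 1 \<Longrightarrow> E k \<subseteq> {1..N} \<times> {1..N}"
    and "\<And>i. i \<in> {1..N} \<Longrightarrow> finite (\<Omega> i)"
    and "weight_condition N E W"
    and "convexity_condition N X0 Df f Dg g \<Omega>"
    and "sampling_condition M N \<Omega> P x \<omega>"
    and "regularity_condition N X0 g \<Omega> P"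
    and "connectivity_condition N E"
    and "optimal_set N X0 f g \<Omega> \<noteq> {}"
    and "\<And>k. k \<ge> 1 \<Longrightarrow> 0 \<le> \<alpha> k"
    and "\<And>k. k \<ge> 1 \<Longrightarrow> \<alpha> (Suc k) \<le> \<alpha> k"
    and "filterlim (\<lambda>n. \<Sum>k=1..n. \<alpha> k) at_top sequentially"
    and "summable (\<lambda>k. (\<alpha> (Suc k))\<^sup>2)"
    and "dap_iterates M N X0 Df f Dg g W \<alpha> d0 \<omega> s d p v x"
  shows "\<exists>xstar \<in> borel_measurable M.
           (\<forall>\<xi>\<in>space M. xstar \<xi> \<in> optimal_set N X0 f g \<Omega>) \<and>
           (AE \<xi> in M. \<forall>i\<in>{1..N}. (\<lambda>k. x i k \<xi>) \<longlonglongrightarrow> xstar \<xi>)"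
proof -
  interpret prob_space M by fact
  note E = assms(2) and fin = assms(3) and wc = assms(4) and cc = assms(5) and sc = assms(6)
    and reg = assms(7) and conn = assms(8) and opt = assms(9) and \<alpha>0 = assms(10)
    and \<alpha>_div = assms(12) and \<alpha>_sq = assms(13) and dap = assms(14)
  let ?X = "feasible_set N X0 g \<Omega>" and ?F = "\<lambda>y. \<Sum>i\<in>{1..N}. f i y"
    and ?O = "optimal_set N X0 f g \<Omega>"
  note X0 = convexity_conditionD(1-3)[OF cc]
  have N: "N \<ge> 1"
  proof -
    obtain Q where "strongly_connected (with_proj \<lparr> pverts = {1..N}, parcs = (\<Union>l\<in>{0..Q - 1}. E (1 + l)) \<rparr>)"
      using conn unfolding connectivity_condition_def by blast
    \<comment> \<open>A strongly connected digraph has a vertex by definition.\<close>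
    then show ?thesis by (auto simp: strongly_connected_def)
  qed
  obtain xs where xs: "xs \<in> ?O" using opt by blast
  then have xs_min: "is_arg_min ?F (\<lambda>y. y \<in> ?X) xs" by (simp add: optimal_set_def)
  then have Xne: "?X \<noteq> {}" by (auto simp: is_arg_min_def)
  have X_X0: "?X \<subseteq> X0" by (auto simp: feasible_set_def)
  have g_X: "g y w \<le> 0" if "y \<in> ?X" "i \<in> {1..N}" "w \<in> \<Omega> i" for y i w
    using that by (auto simp: feasible_set_def constraint_set_def)
  obtain C where C: "0 \<le> C" "\<And>i y u. i \<in> {1..N} \<Longrightarrow> y \<in> X0 \<Longrightarrow> u \<in> subdifferential (Df i) (f i) y \<Longrightarrow> norm u \<le> C"
  proof -
    obtain Cf :: "nat \<Rightarrow> real" where Cf: "\<forall>i\<in>{1..N}. \<forall>y\<in>X0. \<forall>u\<in>subdifferential (Df i) (f i) y. norm u \<le> Cf i"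
      using cc unfolding convexity_condition_def by blast
    show ?thesis
    proof
      show "0 \<le> (\<Sum>i\<in>{1..N}. \<bar>Cf i\<bar>)" by (intro sum_nonneg) simp
      fix i y u assume i: "i \<in> {1..N}" and "y \<in> X0" "u \<in> subdifferential (Df i) (f i) y"
      then have "norm u \<le> \<bar>Cf i\<bar>" using Cf by fastforce
      also have "\<dots> \<le> (\<Sum>i\<in>{1..N}. \<bar>Cf i\<bar>)" using i by (intro member_le_sum) auto
      finally show "norm u \<le> (\<Sum>i\<in>{1..N}. \<bar>Cf i\<bar>)" .
    qed
  qed
  obtain G where G: "0 < G" "\<And>i w y u. i \<in> {1..N} \<Longrightarrow> w \<in> \<Omega> i \<Longrightarrow> y \<in> X0 \<Longrightarrow>
      u \<in> subdifferential (Dg w) (\<lambda>y. gplus g y w) y \<Longrightarrow> norm u \<le> G"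
  proof -
    obtain Cg :: real where Cg: "\<forall>i\<in>{1..N}. \<forall>w\<in>\<Omega> i. \<forall>y\<in>X0.
        \<forall>u\<in>subdifferential (Dg w) (\<lambda>y. gplus g y w) y. norm u \<le> Cg"
      using cc unfolding convexity_condition_def by blast
    show ?thesis
      \<comment> \<open>The bound is later a divisor, so it is made positive.\<close>
      by (rule that[of "max Cg 1"]) (use Cg in \<open>auto simp: le_max_iff_disj\<close>)
  qed
  have \<Omega>_mem: "\<omega> i (Suc k) \<xi> \<in> \<Omega> i" if "i \<in> {1..N}" "\<xi> \<in> space M" for i k \<xi>
    using sc that by (simp add: sampling_condition_def)
  have p: "p i (Suc k) \<xi> = (\<Sum>j\<in>{1..N}. W (Suc k) i j *\<^sub>R x j k \<xi>)"
    and s: "s i (Suc k) \<xi> \<in> subdifferential (Df i) (f i) (p i (Suc k) \<xi>)"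
    and v: "v i (Suc k) \<xi> = closest_point X0 (p i (Suc k) \<xi> - \<alpha> (Suc k) *\<^sub>R s i (Suc k) \<xi>)"
    and d: "if gplus g (v i (Suc k) \<xi>) (\<omega> i (Suc k) \<xi>) > 0
        then d i (Suc k) \<xi> \<in> subdifferential (Dg (\<omega> i (Suc k) \<xi>)) (\<lambda>y. gplus g y (\<omega> i (Suc k) \<xi>)) (v i (Suc k) \<xi>)
        else d i (Suc k) \<xi> = d0 i"
    and x: "x i (Suc k) \<xi> = closest_point X0 (v i (Suc k) \<xi>
        - (gplus g (v i (Suc k) \<xi>) (\<omega> i (Suc k) \<xi>) / (norm (d i (Suc k) \<xi>))\<^sup>2) *\<^sub>R d i (Suc k) \<xi>)"
    if "i \<in> {1..N}" "\<xi> \<in> space M" for i k \<xi>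
  proof -
    have "1 \<le> Suc k" by simp
    note step_k = dap[unfolded dap_iterates_def, THEN conjunct2, THEN conjunct2, THEN bspec, OF that(1),
        THEN spec, THEN mp, OF this, THEN conjunct2, THEN conjunct2, THEN bspec, OF that(2), unfolded diff_Suc_1]
    show "p i (Suc k) \<xi> = (\<Sum>j\<in>{1..N}. W (Suc k) i j *\<^sub>R x j k \<xi>)"
      and "s i (Suc k) \<xi> \<in> subdifferential (Df i) (f i) (p i (Suc k) \<xi>)"
      and "v i (Suc k) \<xi> = closest_point X0 (p i (Suc k) \<xi> - \<alpha> (Suc k) *\<^sub>R s i (Suc k) \<xi>)"
      and "if gplus g (v i (Suc k) \<xi>) (\<omega> i (Suc k) \<xi>) > 0
        then d i (Suc k) \<xi> \<in> subdifferential (Dg (\<omega> i (Suc k) \<xi>)) (\<lambda>y. gplus g y (\<omega> i (Suc k) \<xi>)) (v i (Suc k) \<xi>)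
        else d i (Suc k) \<xi> = d0 i"
      and "x i (Suc k) \<xi> = closest_point X0 (v i (Suc k) \<xi>
        - (gplus g (v i (Suc k) \<xi>) (\<omega> i (Suc k) \<xi>) / (norm (d i (Suc k) \<xi>))\<^sup>2) *\<^sub>R d i (Suc k) \<xi>)"
      by (rule step_k[THEN conjunct1] step_k[THEN conjunct2, THEN conjunct1]
          step_k[THEN conjunct2, THEN conjunct2, THEN conjunct1]
          step_k[THEN conjunct2, THEN conjunct2, THEN conjunct2, THEN conjunct1]
          step_k[THEN conjunct2, THEN conjunct2, THEN conjunct2, THEN conjunct2])+
  qed
  have d0: "d0 i \<noteq> 0" and x0: "\<xi> \<in> space M \<Longrightarrow> x i 0 \<xi> \<in> X0" if "i \<in> {1..N}" for i \<xi>
    using dap that unfolding dap_iterates_def by auto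
  have x_X0: "x i k \<xi> \<in> X0" if "i \<in> {1..N}" "\<xi> \<in> space M" for i k \<xi>
    using x0[OF that] x[OF that] closest_point_in_set[OF X0(2,1)] by (cases k) auto
  have v_X0: "v i (Suc k) \<xi> \<in> X0" if "i \<in> {1..N}" "\<xi> \<in> space M" for i k \<xi>
    using v[OF that] closest_point_in_set[OF X0(2,1)] by simp
  have p_X0: "p i (Suc k) \<xi> \<in> X0" if "i \<in> {1..N}" "\<xi> \<in> space M" for i k \<xi>
    unfolding p[OF that] using that weight_conditionD[OF wc, of "Suc k"]
    by (intro convex_sum X0 x_X0) auto
  have vq: "norm (v i (Suc k) \<xi> - p i (Suc k) \<xi>) \<le> C * \<alpha> (Suc k)"
    and xv: "norm (x i (Suc k) \<xi> - v i (Suc k) \<xi>) \<le> infdist (v i (Suc k) \<xi>) ?X"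
    and xv_infdist: "infdist (x i (Suc k) \<xi>) ?X \<le> infdist (v i (Suc k) \<xi>) ?X"
    and infdist_desc: "(infdist (x i (Suc k) \<xi>) ?X)\<^sup>2 + (gplus g (v i (Suc k) \<xi>) (\<omega> i (Suc k) \<xi>) / G)\<^sup>2
      \<le> (infdist (p i (Suc k) \<xi>) ?X)\<^sup>2 + 2 * (C * \<alpha> (Suc k)) * infdist (p i (Suc k) \<xi>) ?X + (C * \<alpha> (Suc k))\<^sup>2"
    and f_desc: "\<And>y. y \<in> ?X \<Longrightarrow> (norm (x i (Suc k) \<xi> - y))\<^sup>2 \<le> (norm (p i (Suc k) \<xi> - y))\<^sup>2
      - 2 * \<alpha> (Suc k) * (f i (p i (Suc k) \<xi>) - f i y) + (C * \<alpha> (Suc k))\<^sup>2"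
    if "i \<in> {1..N}" "\<xi> \<in> space M" for i k \<xi>
  proof -
    have "0 \<le> \<alpha> (Suc k)" by (rule \<alpha>0) simp
    note step = dap_step[OF X0(2,3) closed_feasible_set[OF cc] Xne X_X0 p_X0[OF that] this s[OF that]
        C(2)[OF that(1) p_X0[OF that] s[OF that]] convexity_conditionD(5)[OF cc that(1)] v[OF that]
        convexity_conditionD(8)[OF cc that(1) \<Omega>_mem[OF that]] g_X[OF _ that(1) \<Omega>_mem[OF that]]
        d[OF that] d0[OF that(1)] G(1) G(2)[OF that(1) \<Omega>_mem[OF that] v_X0[OF that]] x[OF that]]
    show "norm (v i (Suc k) \<xi> - p i (Suc k) \<xi>) \<le> C * \<alpha> (Suc k)" by (rule step(1))
    show "norm (x i (Suc k) \<xi> - v i (Suc k) \<xi>) \<le> infdist (v i (Suc k) \<xi>) ?X" by (rule step(2))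
    show "infdist (x i (Suc k) \<xi>) ?X \<le> infdist (v i (Suc k) \<xi>) ?X" by (rule step(3))
    show "(infdist (x i (Suc k) \<xi>) ?X)\<^sup>2 + (gplus g (v i (Suc k) \<xi>) (\<omega> i (Suc k) \<xi>) / G)\<^sup>2
      \<le> (infdist (p i (Suc k) \<xi>) ?X)\<^sup>2 + 2 * (C * \<alpha> (Suc k)) * infdist (p i (Suc k) \<xi>) ?X + (C * \<alpha> (Suc k))\<^sup>2"
      by (rule step(4))
    show "(norm (x i (Suc k) \<xi> - y))\<^sup>2 \<le> (norm (p i (Suc k) \<xi> - y))\<^sup>2
      - 2 * \<alpha> (Suc k) * (f i (p i (Suc k) \<xi>) - f i y) + (C * \<alpha> (Suc k))\<^sup>2" if "y \<in> ?X" for y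
      using that by - (rule step(5); assumption)
  qed
  have step_AE: "AE \<xi> in M. \<forall>i\<in>{1..N}. summable (\<lambda>k. (infdist (v i (Suc k) \<xi>) ?X)\<^sup>2)"
  proof (rule AE_summable_infdist[OF sc reg wc closed_feasible_set[OF cc] convex_feasible_set[OF cc] Xne X0(2) C(1) G(1) fin
        continuous_on_gplus[OF cc], where q = "\<lambda>i k. p i (Suc k)" and z = x and a = "\<lambda>k. \<alpha> (Suc k)"])
    \<comment> \<open>The Lipschitz bound is applied between \<open>y\<close> and its nearest
      feasible point, where \<open>gplus\<close> vanishes.\<close>
    show "gplus g y w \<le> G * infdist y ?X" if iw: "i \<in> {1..N}" "w \<in> \<Omega> i" and y: "y \<in> X0" for i w y
    proof -
      obtain y1 where y1: "y1 \<in> ?X" "infdist y ?X = dist y y1"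
        using infdist_attains_inf[OF closed_feasible_set[OF cc] Xne] by blast
      have "convex_on (Dg w) (\<lambda>y. gplus g y w)"
        using convexity_conditionD(9)[OF cc iw] by (rule convex_on_gplus[where g = g])
      from convex_Lipschitz_if_subgradients_bounded[OF convexity_conditionD(7)[OF cc iw] this
          convexity_conditionD(8)[OF cc iw] G(2)[OF iw] subsetD[OF X_X0 y1(1)] y]
      have "gplus g y w - gplus g y1 w \<le> G * dist y1 y" .
      moreover have "gplus g y1 w = 0" using g_X[OF y1(1) iw] by (simp add: gplus_def)
      ultimately show ?thesis using y1(2) by (simp add: dist_commute)
    qed
    show "0 \<le> \<alpha> (Suc k)" for k by (rule \<alpha>0) simp
  qed (assumption | rule \<alpha>_sq p v_X0 vq xv_infdist infdist_desc measurable_dap_iterates[OF cc sc dap fin])+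
  have conv: "\<exists>y\<in>?O. \<forall>i\<in>{1..N}. (\<lambda>k. x i k \<xi>) \<longlonglongrightarrow> y"
    if \<xi>: "\<xi> \<in> space M" and sm: "\<forall>i\<in>{1..N}. summable (\<lambda>k. (infdist (v i (Suc k) \<xi>) ?X)\<^sup>2)" for \<xi>
  proof -
    have \<alpha>_nsum: "\<not> summable (\<lambda>k. \<alpha> (Suc k))"
    proof
      assume "summable (\<lambda>k. \<alpha> (Suc k))"
      then have "(\<lambda>n. \<Sum>k=1..n. \<alpha> k) \<longlonglongrightarrow> suminf (\<lambda>k. \<alpha> (Suc k))"
        by (simp add: sum.atLeast1_atMost_eq summable_LIMSEQ)
      with \<alpha>_div show False
        using not_tendsto_and_filterlim_at_infinity filterlim_at_top_imp_at_infinity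
        by (metis sequentially_bot)
    qed
    have lip: "f i y' - f i y \<le> C * dist y y'" if "i \<in> {1..N}" "y \<in> X0" "y' \<in> X0" for i y y'
      using convex_Lipschitz_if_subgradients_bounded[OF convexity_conditionD(4)[OF cc that(1)]
          convexity_conditionD(6)[OF cc that(1)] convexity_conditionD(5)[OF cc that(1)] C(2)[OF that(1)] that(2,3)] .
    have \<alpha>_nonneg: "0 \<le> \<alpha> (Suc k)" for k by (rule \<alpha>0) simp
    obtain y where "is_arg_min ?F (\<lambda>y. y \<in> ?X) y" "\<And>i. i \<in> {1..N} \<Longrightarrow> (\<lambda>k. x i k \<xi>) \<longlonglongrightarrow> y"
      by (rule approximate_projection_convergence[OF wc conn E N closed_feasible_set[OF cc] X_X0 C(1) _ xs_min,
          where a = "\<lambda>k. \<alpha> (Suc k)" and q = "\<lambda>i k. p i (Suc k) \<xi>" and z = "\<lambda>i k. x i k \<xi>"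
            and v = "\<lambda>i k. v i (Suc k) \<xi>"])
        (assumption | rule lip \<alpha>_nonneg \<alpha>_nsum \<alpha>_sq p[OF _ \<xi>] p_X0[OF _ \<xi>] vq[OF _ \<xi>] xv[OF _ \<xi>]
          f_desc[OF _ \<xi>] sm[rule_format] | blast intro: that)+
    then show ?thesis by (auto simp: optimal_set_def)
  qed
  define L where "L \<xi> = lim (\<lambda>k. x 1 k \<xi>)" for \<xi>
  \<comment> \<open>On the exceptional outcomes \<open>lim\<close> may be an arbitrary value;
    replacing it by the fixed optimal point \<open>xs\<close> keeps \<open>xstar\<close> optimal
    everywhere.\<close>
  define xstar where "xstar \<xi> = (if L \<xi> \<in> ?O then L \<xi> else xs)" for \<xi>
  have one: "1 \<in> {1..N}" using N by simp
  have "x 1 k \<in> borel_measurable M" for k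
    using measurable_from_subalg[OF subalgebra_history[OF sc] measurable_dap_iterates(1)[OF cc sc dap fin one]] .
  then have L_meas: "L \<in> borel_measurable M"
    unfolding L_def by (rule borel_measurable_lim_metric)
  have "L -` ?O \<inter> space M \<in> events"
    by (rule measurable_sets[OF L_meas borel_closed[OF closed_optimal_set[OF cc]]])
  then have "{\<xi> \<in> space M. L \<xi> \<in> ?O} \<in> events"
    by (simp add: vimage_def Int_def conj_commute)
  from measurable_If[OF L_meas measurable_const this] have "xstar \<in> borel_measurable M"
    unfolding xstar_def by simp
  moreover have "\<forall>\<xi>\<in>space M. xstar \<xi> \<in> ?O" using xs by (simp add: xstar_def)
  moreover have "AE \<xi> in M. \<forall>i\<in>{1..N}. (\<lambda>k. x i k \<xi>) \<longlonglongrightarrow> xstar \<xi>"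
    using step_AE
  proof (rule AE_mp, intro AE_I2 impI)
    fix \<xi> assume "\<xi> \<in> space M" "\<forall>i\<in>{1..N}. summable (\<lambda>k. (infdist (v i (Suc k) \<xi>) ?X)\<^sup>2)"
    from conv[OF this] obtain y where y: "y \<in> ?O" "\<forall>i\<in>{1..N}. (\<lambda>k. x i k \<xi>) \<longlonglongrightarrow> y" by blast
    then have "L \<xi> = y" using one by (auto simp: L_def intro: limI)
    with y show "\<forall>i\<in>{1..N}. (\<lambda>k. x i k \<xi>) \<longlonglongrightarrow> xstar \<xi>" by (simp add: xstar_def)
  qed
  ultimately show ?thesis by blast
qed

end
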